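(* Let $G$ be a non-trivial finitely generated left-orderable group, generated by $n$ elements $\widetilde{s_1},\ldots,\widetilde{s_n}$. Let $F_n$ be the free group with free generating set $\{s_1,\ldots,s_n\}$, let $\pi_2: F_n\twoheadrightarrow G$ be the natural epimorphism, $\pi_2(s_i)=\widetilde{s_i}$ for $1\le i\le n$, and let $\pi_1: F_n*G\twoheadrightarrow G$ be the epimorphism determined by $\pi_1|_{F_n}=\pi_2$ and $\pi_1|_G=\mathrm{Id}_G$, the identity map on $G$. Then the corresponding fiber product $$P=\{(g_1,g_2)\in (F_n*G)\times F_n : \pi_1(g_1)=\pi_2(g_2)\}$$ is bi-orderable.
   Context: A group $G$ is left-orderable if there exists a strict total ordering $<$ on $G$ such that for all $g,x,y\in G$, $x<y$ implies $gx<gy$. It is bi-orderable if there exists a strict total ordering $<$ on $G$ such that for all $g,h,x,y\in G$, $x<y$ implies $gxh<gyh$. $F_n*G$ denotes the free product; $F_n$ and $G$ are identified with their canonical images in it. The fiber product of epimorphisms $p_1:G_1\to Q$ and $p_2:G_2\to Q$ is the subgroup $\{(g_1,g_2): p_1(g_1)=p_2(g_2)\}$ of $G_1\times G_2$. *)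

theory Defs
  imports "HOL-Algebra.Algebra"
begin

section \<open>Orderings on groups\<close>

definition left_orderable :: "('a, 'b) monoid_scheme \<Rightarrow> bool" where
  "left_orderable G \<longleftrightarrow> group G \<and>
     (\<exists>r. r \<subseteq> carrier G \<times> carrier G \<and> strict_linear_order_on (carrier G) r \<and>
        (\<forall>g\<in>carrier G. \<forall>x\<in>carrier G. \<forall>y\<in>carrier G.
           (x, y) \<in> r \<longrightarrow> (g \<otimes>\<^bsub>G\<^esub> x, g \<otimes>\<^bsub>G\<^esub> y) \<in> r))"

definition bi_orderable :: "('a, 'b) monoid_scheme \<Rightarrow> bool" where
  "bi_orderable G \<longleftrightarrow> group G \<and>
     (\<exists>r. r \<subseteq> carrier G \<times> carrier G \<and> strict_linear_order_on (carrier G) r \<and>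
        (\<forall>g\<in>carrier G. \<forall>h\<in>carrier G. \<forall>x\<in>carrier G. \<forall>y\<in>carrier G.
           (x, y) \<in> r \<longrightarrow> (g \<otimes>\<^bsub>G\<^esub> x \<otimes>\<^bsub>G\<^esub> h, g \<otimes>\<^bsub>G\<^esub> y \<otimes>\<^bsub>G\<^esub> h) \<in> r))"


section \<open>Quotients of word monoids\<close>

text \<open>The congruence on the free monoid \<open>lists S\<close> generated by the pairs in \<open>R\<close>.\<close>

inductive_set word_cong :: "'l set \<Rightarrow> ('l list \<times> 'l list) set \<Rightarrow> ('l list \<times> 'l list) set"
  for S :: "'l set" and R :: "('l list \<times> 'l list) set"
  where
    rel: "\<lbrakk>(u, v) \<in> R; u \<in> lists S; v \<in> lists S; p \<in> lists S; q \<in> lists S\<rbrakk>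
            \<Longrightarrow> (p @ u @ q, p @ v @ q) \<in> word_cong S R"
  | refl: "u \<in> lists S \<Longrightarrow> (u, u) \<in> word_cong S R"
  | sym: "(u, v) \<in> word_cong S R \<Longrightarrow> (v, u) \<in> word_cong S R"
  | trans: "\<lbrakk>(u, v) \<in> word_cong S R; (v, w) \<in> word_cong S R\<rbrakk> \<Longrightarrow> (u, w) \<in> word_cong S R"

definition word_class :: "'l set \<Rightarrow> ('l list \<times> 'l list) set \<Rightarrow> 'l list \<Rightarrow> 'l list set" where
  "word_class S R w = word_cong S R `` {w}"

definition word_monoid :: "'l set \<Rightarrow> ('l list \<times> 'l list) set \<Rightarrow> 'l list set monoid" where
  "word_monoid S R =
     \<lparr>carrier = lists S // word_cong S R,
      monoid.mult = (\<lambda>U V. \<Union>u\<in>U. \<Union>v\<in>V. word_class S R (u @ v)),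
      one = word_class S R []\<rparr>"

declare in_listsD [rule del] in_listsI [rule del]

lemma word_cong_lists: "(u, v) \<in> word_cong S R \<Longrightarrow> u \<in> lists S \<and> v \<in> lists S"
  by (induction rule: word_cong.induct) auto

lemma equiv_word_cong: "equiv (lists S) (word_cong S R)"
proof (rule equivI)
  show "word_cong S R \<subseteq> lists S \<times> lists S"
    by (auto dest: word_cong_lists)
  show "refl_on (lists S) (word_cong S R)"
    by (rule refl_onI) (auto intro: word_cong.refl)
  show "Relation.sym (word_cong S R)"
    by (rule symI) (rule word_cong.sym)
  show "Relation.trans (word_cong S R)"
    by (rule transI) (rule word_cong.trans)
qed

lemma word_cong_append_left:
  "(u, v) \<in> word_cong S R \<Longrightarrow> p \<in> lists S \<Longrightarrow> (p @ u, p @ v) \<in> word_cong S R"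
proof (induction rule: word_cong.induct)
  case (rel u v p' q)
  then show ?case
    using word_cong.rel[of u v R S "p @ p'" q] by auto
next
  case (refl u)
  then show ?case by (intro word_cong.refl) simp
next
  case (sym u v)
  then show ?case by (simp only: word_cong.sym)
next
  case (trans u v w)
  show ?case
    by (rule word_cong.trans[OF trans.IH(1)[OF trans.prems] trans.IH(2)[OF trans.prems]])
qed

lemma word_cong_append_right:
  "(u, v) \<in> word_cong S R \<Longrightarrow> q \<in> lists S \<Longrightarrow> (u @ q, v @ q) \<in> word_cong S R"
proof (induction rule: word_cong.induct)
  case (rel u v p q')
  then show ?case
    using word_cong.rel[of u v R S p "q' @ q"] by auto
next
  case (refl u)
  then show ?case by (intro word_cong.refl) simp
next
  case (sym u v)
  then show ?case by (simp only: word_cong.sym)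
next
  case (trans u v w)
  show ?case
    by (rule word_cong.trans[OF trans.IH(1)[OF trans.prems] trans.IH(2)[OF trans.prems]])
qed

lemma word_cong_append:
  assumes "(u, u') \<in> word_cong S R" "(v, v') \<in> word_cong S R"
  shows "(u @ v, u' @ v') \<in> word_cong S R"
proof (rule word_cong.trans)
  show "(u @ v, u' @ v) \<in> word_cong S R"
    using word_cong_lists[OF assms(2)] word_cong_append_right[OF assms(1)] by blast
  show "(u' @ v, u' @ v') \<in> word_cong S R"
    using word_cong_lists[OF assms(1)] word_cong_append_left[OF assms(2)] by blast
qed

lemma word_class_eq_iff:
  "u \<in> lists S \<Longrightarrow> v \<in> lists S \<Longrightarrow>
     word_class S R u = word_class S R v \<longleftrightarrow> (u, v) \<in> word_cong S R"
  unfolding word_class_def by (rule eq_equiv_class_iff[OF equiv_word_cong])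

lemma carrier_word_monoid: "carrier (word_monoid S R) = word_class S R ` lists S"
  by (auto simp: word_monoid_def quotient_def word_class_def)

lemma one_word_monoid: "\<one>\<^bsub>word_monoid S R\<^esub> = word_class S R []"
  by (simp add: word_monoid_def)

lemma mult_word_monoid:
  assumes "u \<in> lists S" "v \<in> lists S"
  shows "word_class S R u \<otimes>\<^bsub>word_monoid S R\<^esub> word_class S R v = word_class S R (u @ v)"
proof -
  have "congruent2 (word_cong S R) (word_cong S R) (\<lambda>u v. word_class S R (u @ v))"
  proof (rule congruent2I')
    fix u u' v v'
    assume *: "(u, u') \<in> word_cong S R" "(v, v') \<in> word_cong S R"
    then have "u @ v \<in> lists S" "u' @ v' \<in> lists S"
      using word_cong_lists by (simp_all, blast+)
    then show "word_class S R (u @ v) = word_class S R (u' @ v')"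
      using word_cong_append[OF *] by (subst word_class_eq_iff)
  qed
  then show ?thesis
    using UN_equiv_class2[OF equiv_word_cong equiv_word_cong _ assms]
    by (simp add: word_monoid_def word_class_def)
qed

lemma monoid_word_monoid: "monoid (word_monoid S R)"
  by (rule monoidI) (auto simp: carrier_word_monoid one_word_monoid mult_word_monoid)

lemma group_word_monoid:
  assumes "\<And>x. x \<in> S \<Longrightarrow> \<exists>v\<in>lists S. (v @ [x], []) \<in> word_cong S R"
  shows "group (word_monoid S R)"
proof -
  have left_inv: "\<exists>v\<in>lists S. (v @ u, []) \<in> word_cong S R" if "u \<in> lists S" for u
    using that
  proof induction
    case Nil
    have "([] @ [], []) \<in> word_cong S R" by (simp add: word_cong.refl)
    then show ?case by blast
  next
    case (Cons x u)
    from Cons.IH obtain v where v: "v \<in> lists S" "(v @ u, []) \<in> word_cong S R" by blast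
    from assms[OF \<open>x \<in> S\<close>] obtain w where w: "w \<in> lists S" "(w @ [x], []) \<in> word_cong S R"
      by blast
    have "(v @ (w @ [x]) @ u, v @ [] @ u) \<in> word_cong S R"
      using v(1) Cons.hyps(2)
      by (intro word_cong_append_left word_cong_append_right w(2))
    then have "(v @ (w @ [x]) @ u, v @ u) \<in> word_cong S R" by simp
    then have "((v @ w) @ x # u, []) \<in> word_cong S R"
      using word_cong.trans[OF _ v(2)] by simp
    moreover have "v @ w \<in> lists S" using v w by simp
    ultimately show ?case by blast
  qed
  have inv: "\<exists>V\<in>carrier (word_monoid S R). V \<otimes>\<^bsub>word_monoid S R\<^esub> U = \<one>\<^bsub>word_monoid S R\<^esub>"
    if "U \<in> carrier (word_monoid S R)" for U
  proof -
    from that obtain u where u: "u \<in> lists S" "U = word_class S R u"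
      by (auto simp: carrier_word_monoid)
    with left_inv obtain v where v: "v \<in> lists S" "(v @ u, []) \<in> word_cong S R" by blast
    then have "word_class S R v \<otimes>\<^bsub>word_monoid S R\<^esub> U = \<one>\<^bsub>word_monoid S R\<^esub>"
      using u by (simp add: mult_word_monoid one_word_monoid word_class_eq_iff)
    with v(1) show ?thesis by (auto simp: carrier_word_monoid)
  qed
  interpret monoid "word_monoid S R" by (rule monoid_word_monoid)
  show ?thesis
    by (rule groupI) (auto simp: m_assoc inv)
qed

definition word_eval :: "('c, 'd) monoid_scheme \<Rightarrow> ('l \<Rightarrow> 'c) \<Rightarrow> 'l list \<Rightarrow> 'c" where
  "word_eval H f w = foldr (\<lambda>x y. f x \<otimes>\<^bsub>H\<^esub> y) w \<one>\<^bsub>H\<^esub>"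

lemma (in monoid) word_eval_closed:
  "f ` S \<subseteq> carrier G \<Longrightarrow> u \<in> lists S \<Longrightarrow> word_eval G f u \<in> carrier G"
  by (induction u) (auto simp: word_eval_def)

lemma (in monoid) word_eval_append:
  "f ` S \<subseteq> carrier G \<Longrightarrow> u \<in> lists S \<Longrightarrow> v \<in> lists S \<Longrightarrow>
     word_eval G f (u @ v) = word_eval G f u \<otimes> word_eval G f v"
proof (induction u)
  case Nil
  then show ?case using word_eval_closed[of f S v] by (simp add: word_eval_def)
next
  case (Cons x u)
  then show ?case
    using word_eval_closed[of f S u] word_eval_closed[of f S v]
    by (auto simp: word_eval_def m_assoc image_subset_iff)
qed

lemma (in monoid) word_eval_cong:
  assumes "f ` S \<subseteq> carrier G"
    and "\<And>u v. (u, v) \<in> R \<Longrightarrow> u \<in> lists S \<Longrightarrow> v \<in> lists S \<Longrightarrow> word_eval G f u = word_eval G f v"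
  shows "(u, v) \<in> word_cong S R \<Longrightarrow> word_eval G f u = word_eval G f v"
  by (induction rule: word_cong.induct) (auto simp: word_eval_append[OF assms(1)] assms(2))

lemma (in monoid) word_monoid_lift:
  assumes f: "f ` S \<subseteq> carrier G"
    and R: "\<And>u v. (u, v) \<in> R \<Longrightarrow> u \<in> lists S \<Longrightarrow> v \<in> lists S \<Longrightarrow> word_eval G f u = word_eval G f v"
  shows "\<exists>h\<in>hom (word_monoid S R) G. \<forall>u\<in>lists S. h (word_class S R u) = word_eval G f u"
proof -
  define h where "h U = word_eval G f (SOME u. u \<in> lists S \<and> U = word_class S R u)" for U
  have h: "h (word_class S R u) = word_eval G f u" if "u \<in> lists S" for u
  proof -
    let ?v = "SOME v. v \<in> lists S \<and> word_class S R u = word_class S R v"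
    have "?v \<in> lists S \<and> word_class S R u = word_class S R ?v"
      by (rule someI[where x = u]) (use that in simp)
    then have "(u, ?v) \<in> word_cong S R"
      using that word_class_eq_iff by blast
    then show ?thesis
      unfolding h_def using word_eval_cong[OF f R] by simp
  qed
  have "h \<in> hom (word_monoid S R) G"
    by (rule homI)
       (auto simp: carrier_word_monoid mult_word_monoid h word_eval_append[OF f]
          intro: word_eval_closed[OF f])
  with h show ?thesis by blast
qed

lemma word_monoid_hom_unique:
  assumes "group (word_monoid S R)" "group H"
    and "h \<in> hom (word_monoid S R) H" "k \<in> hom (word_monoid S R) H"
    and eq: "\<And>x. x \<in> S \<Longrightarrow> h (word_class S R [x]) = k (word_class S R [x])"
    and "U \<in> carrier (word_monoid S R)"
  shows "h U = k U"
proof -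
  interpret h: group_hom "word_monoid S R" H h
    using assms by (simp add: group_hom_def group_hom_axioms_def)
  interpret k: group_hom "word_monoid S R" H k
    using assms by (simp add: group_hom_def group_hom_axioms_def)
  have "h (word_class S R u) = k (word_class S R u)" if "u \<in> lists S" for u
    using that
  proof induction
    case Nil
    then show ?case using h.hom_one k.hom_one by (simp add: one_word_monoid)
  next
    case (Cons x u)
    have "word_class S R (x # u) = word_class S R [x] \<otimes>\<^bsub>word_monoid S R\<^esub> word_class S R u"
      using Cons.hyps by (simp add: mult_word_monoid)
    moreover have "word_class S R [x] \<in> carrier (word_monoid S R)"
      "word_class S R u \<in> carrier (word_monoid S R)"
      using Cons.hyps by (auto simp: carrier_word_monoid)
    ultimately show ?case using Cons.IH eq[OF \<open>x \<in> S\<close>] by simp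
  qed
  with assms(6) show ?thesis by (auto simp: carrier_word_monoid)
qed


section \<open>Free groups\<close>

text \<open>The letter \<open>(x, True)\<close> stands for the generator \<open>x\<close>, the letter \<open>(x, False)\<close>
  for its inverse.\<close>

definition free_group_letters :: "'i set \<Rightarrow> ('i \<times> bool) set" where
  "free_group_letters A = A \<times> UNIV"

definition free_group_rels :: "'i set \<Rightarrow> (('i \<times> bool) list \<times> ('i \<times> bool) list) set" where
  "free_group_rels A = {([(x, b), (x, \<not> b)], []) | x b. x \<in> A}"

definition free_group :: "'i set \<Rightarrow> ('i \<times> bool) list set monoid" where
  "free_group A = word_monoid (free_group_letters A) (free_group_rels A)"

definition free_gen :: "'i set \<Rightarrow> 'i \<Rightarrow> ('i \<times> bool) list set" where
  "free_gen A x = word_class (free_group_letters A) (free_group_rels A) [(x, True)]"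

lemma free_group_cancel:
  assumes "x \<in> A"
  shows "([(x, b), (x, \<not> b)], []) \<in> word_cong (free_group_letters A) (free_group_rels A)"
  using word_cong.rel[of "[(x, b), (x, \<not> b)]" "[]" "free_group_rels A" "free_group_letters A" "[]" "[]"] assms
  by (auto simp: free_group_rels_def free_group_letters_def)

lemma group_free_group: "group (free_group A)"
  unfolding free_group_def
proof (rule group_word_monoid)
  fix l assume "l \<in> free_group_letters A"
  then obtain x b where l: "l = (x, b)" "x \<in> A" by (auto simp: free_group_letters_def)
  then show "\<exists>v\<in>lists (free_group_letters A).
      (v @ [l], []) \<in> word_cong (free_group_letters A) (free_group_rels A)"
    using free_group_cancel[of x A "\<not> b"]
    by (intro bexI[of _ "[(x, \<not> b)]"]) (auto simp: free_group_letters_def)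
qed

lemma free_gen_in_carrier: "x \<in> A \<Longrightarrow> free_gen A x \<in> carrier (free_group A)"
  by (auto simp: free_gen_def free_group_def carrier_word_monoid free_group_letters_def)

lemma free_group_letter_inv:
  assumes "x \<in> A"
  shows "word_class (free_group_letters A) (free_group_rels A) [(x, False)]
           = inv\<^bsub>free_group A\<^esub> free_gen A x"
proof -
  interpret group "free_group A" by (rule group_free_group)
  have "word_class (free_group_letters A) (free_group_rels A) [(x, False)]
          \<otimes>\<^bsub>free_group A\<^esub> free_gen A x = \<one>\<^bsub>free_group A\<^esub>"
    using assms free_group_cancel[of x A False]
    by (simp add: free_group_def free_gen_def mult_word_monoid one_word_monoid
        word_class_eq_iff free_group_letters_def)
  moreover have "word_class (free_group_letters A) (free_group_rels A) [(x, False)]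
                   \<in> carrier (free_group A)"
    using assms by (simp add: free_group_def carrier_word_monoid free_group_letters_def)
  ultimately show ?thesis
    using free_gen_in_carrier[OF assms] by (metis inv_equality)
qed

theorem free_group_universal:
  assumes H: "group H" and s: "s ` A \<subseteq> carrier H"
  shows "\<exists>h\<in>hom (free_group A) H. \<forall>x\<in>A. h (free_gen A x) = s x"
proof -
  interpret H: group H by (rule H)
  define f where "f = (\<lambda>(x, b). if b then s x else inv\<^bsub>H\<^esub> s x)"
  have f: "f ` free_group_letters A \<subseteq> carrier H"
    using s by (auto simp: f_def free_group_letters_def image_subset_iff)
  have "word_eval H f u = word_eval H f v"
    if "(u, v) \<in> free_group_rels A" for u v
    using that s
    by (auto simp: free_group_rels_def word_eval_def f_def image_subset_iff split: if_splits)
  from H.word_monoid_lift[OF f this]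
  obtain h where h: "h \<in> hom (free_group A) H"
    "\<And>u. u \<in> lists (free_group_letters A) \<Longrightarrow>
       h (word_class (free_group_letters A) (free_group_rels A) u) = word_eval H f u"
    unfolding free_group_def by blast
  have "h (free_gen A x) = s x" if "x \<in> A" for x
    using that s h(2)[of "[(x, True)]"]
    by (auto simp: free_gen_def free_group_letters_def word_eval_def f_def image_subset_iff)
  with h(1) show ?thesis by blast
qed

theorem free_group_hom_unique:
  assumes H: "group H" and h: "h \<in> hom (free_group A) H" and k: "k \<in> hom (free_group A) H"
    and eq: "\<And>x. x \<in> A \<Longrightarrow> h (free_gen A x) = k (free_gen A x)"
    and "U \<in> carrier (free_group A)"
  shows "h U = k U"
proof -
  interpret h: group_hom "free_group A" H h
    using H h group_free_group by (simp add: group_hom_def group_hom_axioms_def)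
  interpret k: group_hom "free_group A" H k
    using H k group_free_group by (simp add: group_hom_def group_hom_axioms_def)
  have "h (word_class (free_group_letters A) (free_group_rels A) [l])
      = k (word_class (free_group_letters A) (free_group_rels A) [l])"
    if l: "l \<in> free_group_letters A" for l
  proof -
    from l obtain x b where l: "l = (x, b)" "x \<in> A"
      by (auto simp: free_group_letters_def)
    show ?thesis
    proof (cases b)
      case True
      then show ?thesis using l eq by (simp add: free_gen_def)
    next
      case False
      then show ?thesis
        using l eq by (simp add: free_group_letter_inv free_gen_in_carrier)
    qed
  qed
  then show ?thesis
    by (rule word_monoid_hom_unique[OF group_free_group[unfolded free_group_def] H
          h[unfolded free_group_def] k[unfolded free_group_def] _ assms(5)[unfolded free_group_def]])
qed


section \<open>Free products\<close>

definition free_product_letters ::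
    "('a, 'c) monoid_scheme \<Rightarrow> ('b, 'd) monoid_scheme \<Rightarrow> ('a + 'b) set" where
  "free_product_letters G H = Inl ` carrier G \<union> Inr ` carrier H"

definition free_product_rels ::
    "('a, 'c) monoid_scheme \<Rightarrow> ('b, 'd) monoid_scheme \<Rightarrow> (('a + 'b) list \<times> ('a + 'b) list) set" where
  "free_product_rels G H =
     {([Inl \<one>\<^bsub>G\<^esub>], []), ([Inr \<one>\<^bsub>H\<^esub>], [])} \<union>
     {([Inl x, Inl y], [Inl (x \<otimes>\<^bsub>G\<^esub> y)]) | x y. x \<in> carrier G \<and> y \<in> carrier G} \<union>
     {([Inr x, Inr y], [Inr (x \<otimes>\<^bsub>H\<^esub> y)]) | x y. x \<in> carrier H \<and> y \<in> carrier H}"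

definition free_product ::
    "('a, 'c) monoid_scheme \<Rightarrow> ('b, 'd) monoid_scheme \<Rightarrow> ('a + 'b) list set monoid" where
  "free_product G H = word_monoid (free_product_letters G H) (free_product_rels G H)"

definition free_product_inl ::
    "('a, 'c) monoid_scheme \<Rightarrow> ('b, 'd) monoid_scheme \<Rightarrow> 'a \<Rightarrow> ('a + 'b) list set" where
  "free_product_inl G H x = word_class (free_product_letters G H) (free_product_rels G H) [Inl x]"

definition free_product_inr ::
    "('a, 'c) monoid_scheme \<Rightarrow> ('b, 'd) monoid_scheme \<Rightarrow> 'b \<Rightarrow> ('a + 'b) list set" where
  "free_product_inr G H y = word_class (free_product_letters G H) (free_product_rels G H) [Inr y]"

lemma free_product_rel_cong:
  assumes "(u, v) \<in> free_product_rels G H"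
    and "u \<in> lists (free_product_letters G H)" "v \<in> lists (free_product_letters G H)"
  shows "(u, v) \<in> word_cong (free_product_letters G H) (free_product_rels G H)"
  using word_cong.rel[of u v "free_product_rels G H" "free_product_letters G H" "[]" "[]"] assms
  by simp

lemma group_free_product:
  assumes G: "group G" and H: "group H"
  shows "group (free_product G H)"
  unfolding free_product_def
proof (rule group_word_monoid)
  interpret G: group G by (rule G)
  interpret H: group H by (rule H)
  let ?S = "free_product_letters G H" and ?R = "free_product_rels G H"
  fix l assume "l \<in> ?S"
  then consider x where "l = Inl x" "x \<in> carrier G" | y where "l = Inr y" "y \<in> carrier H"
    by (auto simp: free_product_letters_def)
  then show "\<exists>v\<in>lists ?S. (v @ [l], []) \<in> word_cong ?S ?R"
  proof cases
    case 1
    have "([Inl (inv\<^bsub>G\<^esub> x), Inl x], [Inl (inv\<^bsub>G\<^esub> x \<otimes>\<^bsub>G\<^esub> x)]) \<in> ?R"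
      unfolding free_product_rels_def using 1 by blast
    then have "([Inl (inv\<^bsub>G\<^esub> x), Inl x], [Inl \<one>\<^bsub>G\<^esub>]) \<in> word_cong ?S ?R"
      using 1 by (intro free_product_rel_cong) (auto simp: free_product_letters_def)
    moreover have "([Inl \<one>\<^bsub>G\<^esub>], []) \<in> word_cong ?S ?R"
      by (rule free_product_rel_cong) (auto simp: free_product_letters_def free_product_rels_def)
    ultimately have "([Inl (inv\<^bsub>G\<^esub> x), Inl x], []) \<in> word_cong ?S ?R"
      by (rule word_cong.trans)
    then show ?thesis
      using 1 by (intro bexI[of _ "[Inl (inv\<^bsub>G\<^esub> x)]"]) (auto simp: free_product_letters_def)
  next
    case 2
    have "([Inr (inv\<^bsub>H\<^esub> y), Inr y], [Inr (inv\<^bsub>H\<^esub> y \<otimes>\<^bsub>H\<^esub> y)]) \<in> ?R"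
      unfolding free_product_rels_def using 2 by blast
    then have "([Inr (inv\<^bsub>H\<^esub> y), Inr y], [Inr \<one>\<^bsub>H\<^esub>]) \<in> word_cong ?S ?R"
      using 2 by (intro free_product_rel_cong) (auto simp: free_product_letters_def)
    moreover have "([Inr \<one>\<^bsub>H\<^esub>], []) \<in> word_cong ?S ?R"
      by (rule free_product_rel_cong) (auto simp: free_product_letters_def free_product_rels_def)
    ultimately have "([Inr (inv\<^bsub>H\<^esub> y), Inr y], []) \<in> word_cong ?S ?R"
      by (rule word_cong.trans)
    then show ?thesis
      using 2 by (intro bexI[of _ "[Inr (inv\<^bsub>H\<^esub> y)]"]) (auto simp: free_product_letters_def)
  qed
qed

lemma free_product_inl_hom:
  assumes "group G"
  shows "free_product_inl G H \<in> hom G (free_product G H)"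
proof (rule homI)
  interpret G: group G by (rule assms)
  fix x y assume xy: "x \<in> carrier G" "y \<in> carrier G"
  show "free_product_inl G H x \<in> carrier (free_product G H)"
    using xy by (auto simp: free_product_inl_def free_product_def carrier_word_monoid free_product_letters_def)
  have "([Inl x, Inl y], [Inl (x \<otimes>\<^bsub>G\<^esub> y)]) \<in> word_cong (free_product_letters G H) (free_product_rels G H)"
    using xy by (intro free_product_rel_cong) (auto simp: free_product_letters_def free_product_rels_def)
  then show "free_product_inl G H (x \<otimes>\<^bsub>G\<^esub> y)
      = free_product_inl G H x \<otimes>\<^bsub>free_product G H\<^esub> free_product_inl G H y"
    using xy by (simp add: free_product_inl_def free_product_def mult_word_monoid
        word_class_eq_iff free_product_letters_def word_cong.sym)
qed

lemma free_product_inr_hom: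
  assumes "group H"
  shows "free_product_inr G H \<in> hom H (free_product G H)"
proof (rule homI)
  interpret H: group H by (rule assms)
  fix x y assume xy: "x \<in> carrier H" "y \<in> carrier H"
  show "free_product_inr G H x \<in> carrier (free_product G H)"
    using xy by (auto simp: free_product_inr_def free_product_def carrier_word_monoid free_product_letters_def)
  have "([Inr x, Inr y], [Inr (x \<otimes>\<^bsub>H\<^esub> y)]) \<in> word_cong (free_product_letters G H) (free_product_rels G H)"
    using xy by (intro free_product_rel_cong) (auto simp: free_product_letters_def free_product_rels_def)
  then show "free_product_inr G H (x \<otimes>\<^bsub>H\<^esub> y)
      = free_product_inr G H x \<otimes>\<^bsub>free_product G H\<^esub> free_product_inr G H y"
    using xy by (simp add: free_product_inr_def free_product_def mult_word_monoid
        word_class_eq_iff free_product_letters_def word_cong.sym)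
qed

theorem free_product_universal:
  assumes G: "group G" and H: "group H" and K: "group K"
    and f: "f \<in> hom G K" and g: "g \<in> hom H K"
  shows "\<exists>h\<in>hom (free_product G H) K.
           (\<forall>x\<in>carrier G. h (free_product_inl G H x) = f x) \<and>
           (\<forall>y\<in>carrier H. h (free_product_inr G H y) = g y)"
proof -
  interpret f: group_hom G K f using G K f by (simp add: group_hom_def group_hom_axioms_def)
  interpret g: group_hom H K g using H K g by (simp add: group_hom_def group_hom_axioms_def)
  let ?S = "free_product_letters G H" and ?R = "free_product_rels G H" and ?f = "case_sum f g"
  have S: "?f ` ?S \<subseteq> carrier K" by (auto simp: free_product_letters_def)
  have "word_eval K ?f u = word_eval K ?f v" if "(u, v) \<in> ?R" for u v
    using that by (auto simp: free_product_rels_def word_eval_def)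
  from f.H.word_monoid_lift[OF S this]
  obtain h where h: "h \<in> hom (free_product G H) K"
    "\<And>u. u \<in> lists ?S \<Longrightarrow> h (word_class ?S ?R u) = word_eval K ?f u"
    unfolding free_product_def by blast
  have "h (free_product_inl G H x) = f x" if "x \<in> carrier G" for x
    using that h(2)[of "[Inl x]"]
    by (simp add: free_product_inl_def free_product_letters_def word_eval_def)
  moreover have "h (free_product_inr G H y) = g y" if "y \<in> carrier H" for y
    using that h(2)[of "[Inr y]"]
    by (simp add: free_product_inr_def free_product_letters_def word_eval_def)
  ultimately show ?thesis using h(1) by blast
qed

theorem free_product_hom_unique:
  assumes G: "group G" and H: "group H" and K: "group K"
    and h: "h \<in> hom (free_product G H) K" and k: "k \<in> hom (free_product G H) K"
    and "\<And>x. x \<in> carrier G \<Longrightarrow> h (free_product_inl G H x) = k (free_product_inl G H x)"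
    and "\<And>y. y \<in> carrier H \<Longrightarrow> h (free_product_inr G H y) = k (free_product_inr G H y)"
    and U: "U \<in> carrier (free_product G H)"
  shows "h U = k U"
proof (rule word_monoid_hom_unique[OF group_free_product[OF G H, unfolded free_product_def] K
      h[unfolded free_product_def] k[unfolded free_product_def] _ U[unfolded free_product_def]])
  fix l assume "l \<in> free_product_letters G H"
  then show "h (word_class (free_product_letters G H) (free_product_rels G H) [l])
      = k (word_class (free_product_letters G H) (free_product_rels G H) [l])"
    using assms(6,7)
    by (auto simp: free_product_letters_def free_product_inl_def free_product_inr_def)
qed

declare in_listsD [dest!] in_listsI [intro!]


section \<open>Fiber products\<close>

definition fiber_product ::
    "('a, 'c) monoid_scheme \<Rightarrow> ('b, 'd) monoid_scheme \<Rightarrow> ('a \<Rightarrow> 'q) \<Rightarrow> ('b \<Rightarrow> 'q) \<Rightarrow> ('a \<times> 'b) monoid" where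
  "fiber_product G1 G2 p1 p2 =
     (G1 \<times>\<times> G2)\<lparr>carrier := {(g1, g2) \<in> carrier G1 \<times> carrier G2. p1 g1 = p2 g2}\<rparr>"

lemma subgroup_fiber_product:
  assumes "group G1" "group G2" "group Q" "p1 \<in> hom G1 Q" "p2 \<in> hom G2 Q"
  shows "subgroup (carrier (fiber_product G1 G2 p1 p2)) (G1 \<times>\<times> G2)"
proof -
  interpret p1: group_hom G1 Q p1 using assms by (simp add: group_hom_def group_hom_axioms_def)
  interpret p2: group_hom G2 Q p2 using assms by (simp add: group_hom_def group_hom_axioms_def)
  interpret D: group "G1 \<times>\<times> G2" using assms by (simp add: DirProd_group)
  have one: "(\<one>\<^bsub>G1\<^esub>, \<one>\<^bsub>G2\<^esub>) \<in> carrier (fiber_product G1 G2 p1 p2)"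
    by (simp add: fiber_product_def)
  show ?thesis
  proof (rule D.subgroupI)
    show "carrier (fiber_product G1 G2 p1 p2) \<noteq> {}" using one by blast
  qed (auto simp: fiber_product_def inv_DirProd[OF assms(1,2)])
qed

end

theory Submission
  imports Defs
begin

text \<open>Write \<open>A = {1..n}\<close> and \<open>X = G \<times> A\<close>. In \<open>F\<^sub>n * G\<close> put
  \<open>x\<^bsub>(g,i)\<^esub> = g s\<^sub>i t\<^sub>i\<inverse> g\<inverse>\<close>, where \<open>t\<^sub>i\<close> is the image of \<open>s\<^sub>i\<close> in \<open>G\<close>. These elements lie in
  the kernel \<open>K\<close> of \<open>\<pi>\<^sub>1\<close>, and conjugation by \<open>h \<in> G\<close> moves \<open>x\<^bsub>(g,i)\<^esub>\<close> to \<open>x\<^bsub>(hg,i)\<^esub>\<close>. In fact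
  \<open>F\<^sub>n * G\<close> is the semidirect product of the free group \<open>F\<^sub>X\<close> and \<open>G\<close>, where \<open>G\<close> acts by left
  translation on the basis \<open>X\<close>: the universal properties give homomorphisms in both directions,
  and composing them yields the identity of \<open>F\<^sub>n * G\<close>, so the first one is injective
  (\<open>retraction_embedding\<close>). It maps \<open>K\<close> into \<open>F\<^sub>X\<close>, and there conjugation by an element of
  \<open>F\<^sub>n * G\<close> acts as a translation of the basis followed by an inner automorphism of \<open>F\<^sub>X\<close>.

  The projection of the fiber product to \<open>F\<^sub>n\<close> has kernel \<open>K \<times> 1\<close>. A group is bi-orderable if it maps
  to a bi-ordered group such that the kernel has a positive cone invariant under conjugation by the
  whole group: order by the image first and by the kernel second (\<open>bi_cone_extension\<close>). So it
  remains to order \<open>F\<^sub>n\<close> and to find on \<open>F\<^sub>X\<close> a bi-ordering that all translations of \<open>X\<close> preserve.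
  A left-ordering of \<open>G\<close>, combined lexicographically with the order of the indices, is a total
  order of \<open>X\<close> preserved by translations. Magnus's ordering of a free group on a totally ordered basis
  is preserved by every automorphism induced by an order automorphism of the basis, hence by the
  action of \<open>G\<close>.

  Magnus's ordering is obtained from the embedding of the free group into noncommutative power
  series with integer coefficients that sends a generator \<open>a\<close> to \<open>1 + a\<close>. Compare words by length
  and then lexicographically, and call an element positive if its series has a positive coefficient
  at the least nonempty word where the coefficient is not zero. In lowest degree the product of two
  series with constant term one is the sum, and conjugation does not change the lowest-degree part;
  this gives a bi-invariant positive cone (\<open>bi_cone_magnus_cone\<close>). The construction refers to the
  basis only through its order, hence the invariance (\<open>magnus_cone_order_automorphism\<close>).\<close>


section \<open>Positive cones\<close>

text \<open>With \<open>N\<close> a normal subgroup of \<open>G\<close>, this describes the positive elements of a bi-ordering of \<open>N\<close>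
  that is preserved by conjugation in all of \<open>G\<close>. That \<open>x\<close> and its inverse are not both positive follows
  from closure under products, because \<open>\<one>\<close> is not positive.\<close>
definition invariant_cone :: "('a, 'b) monoid_scheme \<Rightarrow> 'a set \<Rightarrow> 'a set \<Rightarrow> bool" where
  "invariant_cone G N C \<longleftrightarrow> C \<subseteq> N \<and> \<one>\<^bsub>G\<^esub> \<notin> C \<and>
     (\<forall>x\<in>C. \<forall>y\<in>C. x \<otimes>\<^bsub>G\<^esub> y \<in> C) \<and>
     (\<forall>g\<in>carrier G. \<forall>x\<in>C. g \<otimes>\<^bsub>G\<^esub> x \<otimes>\<^bsub>G\<^esub> inv\<^bsub>G\<^esub> g \<in> C) \<and>
     (\<forall>x\<in>N. x \<noteq> \<one>\<^bsub>G\<^esub> \<longrightarrow> x \<in> C \<or> inv\<^bsub>G\<^esub> x \<in> C)"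

abbreviation bi_cone :: "('a, 'b) monoid_scheme \<Rightarrow> 'a set \<Rightarrow> bool" where
  "bi_cone G \<equiv> invariant_cone G (carrier G)"

lemma invariant_coneD:
  assumes "invariant_cone G N C"
  shows "C \<subseteq> N" "\<one>\<^bsub>G\<^esub> \<notin> C"
    and "\<And>x y. x \<in> C \<Longrightarrow> y \<in> C \<Longrightarrow> x \<otimes>\<^bsub>G\<^esub> y \<in> C"
    and "\<And>g x. g \<in> carrier G \<Longrightarrow> x \<in> C \<Longrightarrow> g \<otimes>\<^bsub>G\<^esub> x \<otimes>\<^bsub>G\<^esub> inv\<^bsub>G\<^esub> g \<in> C"
    and "\<And>x. x \<in> N \<Longrightarrow> x \<noteq> \<one>\<^bsub>G\<^esub> \<Longrightarrow> x \<in> C \<or> inv\<^bsub>G\<^esub> x \<in> C"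
  using assms by (simp_all add: invariant_cone_def)

lemma bi_orderable_if_bi_cone:
  fixes G (structure)
  assumes "group G" and "bi_cone G C"
  shows "bi_orderable G"
proof -
  interpret group G by fact
  note one = invariant_coneD(2)[OF assms(2)] and mult = invariant_coneD(3)[OF assms(2)]
    and conj = invariant_coneD(4)[OF assms(2)] and tot = invariant_coneD(5)[OF assms(2)]
  have cancel: "x \<otimes> (inv x \<otimes> y) = y" "inv x \<otimes> (x \<otimes> y) = y"
    if "x \<in> carrier G" "y \<in> carrier G" for x y
    using that by (simp_all flip: m_assoc)
  define r where "r = {(x, y). x \<in> carrier G \<and> y \<in> carrier G \<and> inv x \<otimes> y \<in> C}"
  have "Relation.trans r"
  proof (rule transI)
    fix x y z assume *: "(x, y) \<in> r" "(y, z) \<in> r"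
    then have c: "x \<in> carrier G" "y \<in> carrier G" "z \<in> carrier G" by (auto simp: r_def)
    have "inv x \<otimes> z = (inv x \<otimes> y) \<otimes> (inv y \<otimes> z)"
      using c by (simp add: m_assoc cancel)
    then show "(x, z) \<in> r" using * mult by (auto simp: r_def)
  qed
  moreover have "irrefl r" by (rule irreflI) (auto simp: r_def one)
  moreover have "total_on (carrier G) r"
  proof (rule total_onI)
    fix x y assume c: "x \<in> carrier G" "y \<in> carrier G" and "x \<noteq> y"
    then have "inv x \<otimes> y \<noteq> \<one>" using cancel(1)[of x y] by auto
    moreover have "inv (inv x \<otimes> y) = inv y \<otimes> x" using c by (simp add: inv_mult_group)
    ultimately show "(x, y) \<in> r \<or> (y, x) \<in> r" using c tot[of "inv x \<otimes> y"] by (auto simp: r_def)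
  qed
  moreover have "(g \<otimes> x \<otimes> h, g \<otimes> y \<otimes> h) \<in> r"
    if c: "g \<in> carrier G" "h \<in> carrier G" "x \<in> carrier G" "y \<in> carrier G" and "(x, y) \<in> r" for g h x y
  proof -
    have "inv (g \<otimes> x \<otimes> h) \<otimes> (g \<otimes> y \<otimes> h) = inv h \<otimes> (inv x \<otimes> y) \<otimes> inv (inv h)"
      using c by (simp add: inv_mult_group m_assoc cancel)
    then show ?thesis
      using that conj[of "inv h" "inv x \<otimes> y"] by (auto simp: r_def simp del: inv_inv)
  qed
  ultimately show ?thesis
    unfolding bi_orderable_def strict_linear_order_on_def
    using is_group by (intro conjI exI[of _ r]) (auto simp: r_def)
qed

text \<open>Order by the image in \<open>Q\<close> first, and by the kernel among elements with the same image. Conjugation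
  in \<open>E\<close> preserves the first criterion because \<open>C\<close> is conjugation invariant in \<open>Q\<close>; for the second
  criterion, invariance of \<open>D\<close> under the kernel alone would not be enough.\<close>
lemma bi_cone_extension:
  assumes "group_hom E Q \<phi>" and "bi_cone Q C" and "invariant_cone E (kernel E Q \<phi>) D"
  shows "bi_cone E (D \<union> {x \<in> carrier E. \<phi> x \<in> C})"
proof -
  interpret group_hom E Q \<phi> by fact
  note C = invariant_coneD[OF assms(2)] and D = invariant_coneD[OF assms(3)]
  have DE: "x \<in> carrier E" "\<phi> x = \<one>\<^bsub>Q\<^esub>" if "x \<in> D" for x
    using D(1) that by (auto simp: kernel_def)
  show ?thesis
    unfolding invariant_cone_def
  proof (intro conjI ballI impI)
    fix x assume "x \<in> carrier E" "x \<noteq> \<one>\<^bsub>E\<^esub>"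
    then show "x \<in> D \<union> {x \<in> carrier E. \<phi> x \<in> C} \<or> inv\<^bsub>E\<^esub> x \<in> D \<union> {x \<in> carrier E. \<phi> x \<in> C}"
      using D(5)[of x] C(5)[of "\<phi> x"] by (cases "\<phi> x = \<one>\<^bsub>Q\<^esub>") (auto simp: kernel_def)
  qed (use C D(2-4) DE in auto)
qed


section \<open>Homomorphisms and induction on free groups\<close>

lemma free_group_induct [consumes 1, case_names one gen inv_gen]:
  assumes "U \<in> carrier (free_group A)"
    and one: "P \<one>\<^bsub>free_group A\<^esub>"
    and gen: "\<And>a U. a \<in> A \<Longrightarrow> U \<in> carrier (free_group A) \<Longrightarrow> P U \<Longrightarrow> P (free_gen A a \<otimes>\<^bsub>free_group A\<^esub> U)"
    and inv_gen: "\<And>a U. a \<in> A \<Longrightarrow> U \<in> carrier (free_group A) \<Longrightarrow> P U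
      \<Longrightarrow> P (inv\<^bsub>free_group A\<^esub> (free_gen A a) \<otimes>\<^bsub>free_group A\<^esub> U)"
  shows "P U"
proof -
  let ?S = "free_group_letters A" and ?R = "free_group_rels A"
  have "P (word_class ?S ?R u)" if "u \<in> lists ?S" for u
    using that
  proof induction
    case Nil
    then show ?case using one by (simp add: free_group_def one_word_monoid)
  next
    case (Cons x u)
    obtain a b where x: "x = (a, b)" "a \<in> A" using Cons.hyps by (auto simp: free_group_letters_def)
    have eq: "word_class ?S ?R (x # u) = word_class ?S ?R [x] \<otimes>\<^bsub>free_group A\<^esub> word_class ?S ?R u"
      using Cons.hyps by (simp add: free_group_def mult_word_monoid)
    have "word_class ?S ?R u \<in> carrier (free_group A)"
      using Cons.hyps by (simp add: free_group_def carrier_word_monoid)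
    then show ?case
      unfolding eq using gen[OF x(2) _ Cons.IH] inv_gen[OF x(2) _ Cons.IH] x(2)
        free_group_letter_inv[OF x(2)]
      by (cases b) (simp_all add: x(1) free_gen_def)
  qed
  moreover obtain u where "u \<in> lists ?S" "U = word_class ?S ?R u"
    using assms(1) unfolding free_group_def carrier_word_monoid by blast
  ultimately show ?thesis by simp
qed

definition free_group_map :: "'x set \<Rightarrow> ('x \<Rightarrow> 'x) \<Rightarrow> ('x \<times> bool) list set \<Rightarrow> ('x \<times> bool) list set" where
  "free_group_map A \<sigma> =
     (SOME h. h \<in> hom (free_group A) (free_group A) \<and> (\<forall>a\<in>A. h (free_gen A a) = free_gen A (\<sigma> a)))"

lemma
  assumes "\<sigma> ` A \<subseteq> A"
  shows free_group_map_hom: "free_group_map A \<sigma> \<in> hom (free_group A) (free_group A)"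
    and free_group_map_gen: "a \<in> A \<Longrightarrow> free_group_map A \<sigma> (free_gen A a) = free_gen A (\<sigma> a)"
proof -
  let ?P = "\<lambda>h. h \<in> hom (free_group A) (free_group A) \<and> (\<forall>a\<in>A. h (free_gen A a) = free_gen A (\<sigma> a))"
  have "(\<lambda>a. free_gen A (\<sigma> a)) ` A \<subseteq> carrier (free_group A)"
    using assms by (simp add: image_subset_iff free_gen_in_carrier)
  from free_group_universal[OF group_free_group this] have "Ex ?P" by (simp only: Bex_def)
  then have "?P (free_group_map A \<sigma>)"
    unfolding free_group_map_def by (rule someI_ex)
  then show "free_group_map A \<sigma> \<in> hom (free_group A) (free_group A)"
    "a \<in> A \<Longrightarrow> free_group_map A \<sigma> (free_gen A a) = free_gen A (\<sigma> a)"
    by (rule conjunct1, rule bspec[OF conjunct2])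
qed


section \<open>Noncommutative power series\<close>

text \<open>A power series in noncommuting variables is encoded by its coefficient function on words.
  The product sums over all ways to cut a word in two; peeling off the first letter turns this sum
  into a recursion, which makes the ring laws plain inductions and needs no finiteness of the
  alphabet.\<close>

primrec ser_mult :: "('x list \<Rightarrow> int) \<Rightarrow> ('x list \<Rightarrow> int) \<Rightarrow> 'x list \<Rightarrow> int" where
  "ser_mult f g [] = f [] * g []"
| "ser_mult f g (a # w) = f [] * g (a # w) + ser_mult (\<lambda>u. f (a # u)) g w"

lemma ser_mult_linear_left:
  "ser_mult (\<lambda>u. c * f u + g u) h w = c * ser_mult f h w + ser_mult g h w"
  by (induction w arbitrary: f g) (auto simp: algebra_simps)

lemma ser_mult_assoc: "ser_mult (ser_mult f g) h w = ser_mult f (ser_mult g h) w"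
  by (induction w arbitrary: f) (auto simp: algebra_simps ser_mult_linear_left)

lemma ser_mult_zero_left: "ser_mult (\<lambda>u. 0) g w = 0"
  by (induction w) auto

definition ser_one :: "'x list \<Rightarrow> int" where
  "ser_one w = (if w = [] then 1 else 0)"

lemma ser_mult_one_left: "ser_mult ser_one g w = g w"
  by (cases w) (auto simp: ser_one_def ser_mult_zero_left)

lemma ser_mult_one_right: "ser_mult f ser_one w = f w"
  by (induction w arbitrary: f) (auto simp: ser_one_def)

lemma ser_mult_nonzeroD:
  "ser_mult f g w \<noteq> 0 \<Longrightarrow> \<exists>u v. w = u @ v \<and> f u \<noteq> 0 \<and> g v \<noteq> 0"
proof (induction w arbitrary: f)
  case (Cons a w)
  then consider "f [] * g (a # w) \<noteq> 0" | "ser_mult (\<lambda>u. f (a # u)) g w \<noteq> 0" by fastforce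
  then show ?case
  proof cases
    case 2
    from Cons.IH[OF this] obtain u v where "w = u @ v" "f (a # u) \<noteq> 0" "g v \<noteq> 0" by blast
    then show ?thesis by (intro exI[of _ "a # u"] exI[of _ v]) simp
  qed (auto intro: exI[of _ "[]"])
qed auto

lemma ser_mult_only_full_prefix:
  assumes "\<And>u. length u < length w \<Longrightarrow> f u = 0"
  shows "ser_mult f g w = f w * g []"
  using assms
proof (induction w arbitrary: f)
  case (Cons a w)
  then have "ser_mult (\<lambda>u. f (a # u)) g w = f (a # w) * g []" by (intro Cons.IH) simp
  then show ?case using Cons.prems[of "[]"] by simp
qed simp

lemma ser_mult_only_empty_prefix:
  assumes "\<And>u. length u < length w \<Longrightarrow> g u = 0"
  shows "ser_mult f g w = f [] * g w"
  using assms
proof (induction w arbitrary: f)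
  case (Cons a w)
  then have "ser_mult (\<lambda>u. f (a # u)) g w = f [a] * g w" by simp
  then show ?case using Cons.prems[of w] by simp
qed simp

text \<open>Among the cuts of \<open>w\<close> only the two trivial ones contribute if one factor has no terms of degree
  strictly between zero and the length of \<open>w\<close>: modulo higher terms, multiplication of series with
  constant term one is addition.\<close>
lemma ser_mult_low_left:
  assumes "f [] = 1" "g [] = 1" "w \<noteq> []"
    and "\<And>u. u \<noteq> [] \<Longrightarrow> length u < length w \<Longrightarrow> f u = 0"
  shows "ser_mult f g w = f w + g w"
proof (cases w)
  case (Cons a v)
  have "ser_mult (\<lambda>u. f (a # u)) g v = f (a # v) * g []"
    by (rule ser_mult_only_full_prefix) (use assms(4) Cons in auto)
  then show ?thesis using assms Cons by simp
qed (use assms in simp)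

lemma ser_mult_low_right:
  assumes "f [] = 1" "g [] = 1" "w \<noteq> []"
    and "\<And>u. u \<noteq> [] \<Longrightarrow> length u < length w \<Longrightarrow> g u = 0"
  shows "ser_mult f g w = f w + g w"
proof -
  have "ser_mult f g w = ser_mult f ser_one w + ser_mult f (\<lambda>u. g u - ser_one u) w"
    by (induction w arbitrary: f) (auto simp: algebra_simps)
  also have "ser_mult f (\<lambda>u. g u - ser_one u) w = f [] * (g w - ser_one w)"
    by (rule ser_mult_only_empty_prefix) (use assms in \<open>auto simp: ser_one_def\<close>)
  finally show ?thesis using assms by (simp add: ser_mult_one_right ser_one_def[of w])
qed

text \<open>The series with constant term one that involve only finitely many letters. The alphabet may be
  infinite, and the restriction to finitely many letters is what makes leading terms exist
  (see \<open>leading_exists\<close> below).\<close>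
definition series_monoid :: "'x set \<Rightarrow> ('x list \<Rightarrow> int) monoid" where
  "series_monoid A =
     \<lparr>carrier = {f. f [] = 1 \<and> (\<exists>B. finite B \<and> B \<subseteq> A \<and> (\<forall>w. f w \<noteq> 0 \<longrightarrow> w \<in> lists B))},
      monoid.mult = ser_mult,
      one = ser_one\<rparr>"

lemma mult_series_monoid [simp]: "f \<otimes>\<^bsub>series_monoid A\<^esub> g = ser_mult f g"
  and one_series_monoid [simp]: "\<one>\<^bsub>series_monoid A\<^esub> = ser_one"
  by (simp_all add: series_monoid_def)

lemma monoid_series_monoid: "monoid (series_monoid A)"
proof (rule monoidI)
  fix f g assume fg: "f \<in> carrier (series_monoid A)" "g \<in> carrier (series_monoid A)"
  then obtain B C where B: "finite B" "B \<subseteq> A" "\<forall>w. f w \<noteq> 0 \<longrightarrow> w \<in> lists B"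
    and C: "finite C" "C \<subseteq> A" "\<forall>w. g w \<noteq> 0 \<longrightarrow> w \<in> lists C"
    by (auto simp: series_monoid_def)
  have "w \<in> lists (B \<union> C)" if nz: "ser_mult f g w \<noteq> 0" for w
  proof -
    obtain u v where "w = u @ v" "f u \<noteq> 0" "g v \<noteq> 0" using ser_mult_nonzeroD[OF nz] by blast
    then show ?thesis using B(3) C(3) by (force simp: in_lists_conv_set)
  qed
  then show "f \<otimes>\<^bsub>series_monoid A\<^esub> g \<in> carrier (series_monoid A)"
    using B C fg by (auto simp: series_monoid_def intro!: exI[of _ "B \<union> C"])
next
  show "\<one>\<^bsub>series_monoid A\<^esub> \<in> carrier (series_monoid A)"
    by (auto simp: series_monoid_def ser_one_def intro!: exI[of _ "{}"])
qed (simp_all add: ser_mult_assoc ser_mult_one_left ser_mult_one_right fun_eq_iff)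


section \<open>The Magnus embedding\<close>

text \<open>The series \<open>1 + a\<close> and its inverse, the alternating geometric series
  \<open>1 - a + a\<^sup>2 - \<dots>\<close>.\<close>
definition magnus_letter :: "'x \<Rightarrow> bool \<Rightarrow> 'x list \<Rightarrow> int" where
  "magnus_letter a b w =
     (if b then (if w = [] \<or> w = [a] then 1 else 0)
      else (if set w \<subseteq> {a} then (- 1) ^ length w else 0))"

lemma magnus_letter_cancel: "ser_mult (magnus_letter a b) (magnus_letter a (\<not> b)) w = ser_one w"
proof (cases b)
  case True
  show ?thesis
  proof (cases w)
    case (Cons c v)
    have "(\<lambda>u. magnus_letter a True (c # u)) = (\<lambda>u. (if c = a then 1 else 0) * ser_one u + 0)"
      by (auto simp: magnus_letter_def ser_one_def)
    then have "ser_mult (\<lambda>u. magnus_letter a True (c # u)) g v = (if c = a then g v else 0)" for g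
      using ser_mult_linear_left[of "if c = a then 1 else 0" ser_one "\<lambda>u. 0" g v]
      by (simp add: ser_mult_one_left ser_mult_zero_left)
    with True Cons show ?thesis by (auto simp: magnus_letter_def ser_one_def)
  qed (auto simp: magnus_letter_def ser_one_def)
next
  case False
  have "ser_mult (magnus_letter a False) (magnus_letter a True) w = ser_one w"
  proof (induction w)
    case (Cons c v)
    have "(\<lambda>u. magnus_letter a False (c # u))
        = (\<lambda>u. (if c = a then - 1 else 0) * magnus_letter a False u + 0)"
      by (auto simp: magnus_letter_def)
    then have "ser_mult (\<lambda>u. magnus_letter a False (c # u)) g v
        = (if c = a then - 1 else 0) * ser_mult (magnus_letter a False) g v" for g
      using ser_mult_linear_left[of "if c = a then - 1 else 0" "magnus_letter a False" "\<lambda>u. 0" g v]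
      by (simp add: ser_mult_zero_left)
    then show ?case using Cons.IH
      by (simp add: ser_one_def[of v] ser_one_def[of "c # v"]
          magnus_letter_def[of a False "[]"] magnus_letter_def[of a True "c # v"])
  qed (simp add: magnus_letter_def ser_one_def)
  with False show ?thesis by simp
qed

lemma magnus_letter_in_carrier: "a \<in> A \<Longrightarrow> magnus_letter a b \<in> carrier (series_monoid A)"
  by (auto simp: series_monoid_def magnus_letter_def intro!: exI[of _ "{a}"] split: if_splits)

lemma magnus_exists:
  "\<exists>M\<in>hom (free_group A) (series_monoid A).
     \<forall>a\<in>A. M (free_gen A a) = magnus_letter a True \<and>
           M (inv\<^bsub>free_group A\<^esub> (free_gen A a)) = magnus_letter a False"
proof -
  interpret S: monoid "series_monoid A" by (rule monoid_series_monoid)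
  let ?S = "free_group_letters A" and ?R = "free_group_rels A" and ?f = "\<lambda>(a, b). magnus_letter a b"
  have "?f ` ?S \<subseteq> carrier (series_monoid A)"
    by (auto simp: free_group_letters_def magnus_letter_in_carrier)
  moreover have "word_eval (series_monoid A) ?f u = word_eval (series_monoid A) ?f v"
    if "(u, v) \<in> ?R" for u v
    using that magnus_letter_in_carrier[THEN S.r_one]
    by (auto simp: free_group_rels_def word_eval_def magnus_letter_cancel fun_eq_iff ser_mult_assoc[symmetric]
        ser_mult_one_right)
  ultimately obtain M where M: "M \<in> hom (free_group A) (series_monoid A)"
    "\<And>u. u \<in> lists ?S \<Longrightarrow> M (word_class ?S ?R u) = word_eval (series_monoid A) ?f u"
    using S.word_monoid_lift[of ?f ?S ?R] unfolding free_group_def by blast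
  have letter: "M (word_class ?S ?R [(a, b)]) = magnus_letter a b" if "a \<in> A" for a b
    using that by (subst M(2)) (auto simp: free_group_letters_def word_eval_def ser_mult_one_right fun_eq_iff)
  have "M (free_gen A a) = magnus_letter a True \<and>
      M (inv\<^bsub>free_group A\<^esub> (free_gen A a)) = magnus_letter a False" if "a \<in> A" for a
    using letter[OF that, of True] letter[OF that, of False]
    unfolding free_group_letter_inv[OF that] free_gen_def[symmetric] by (rule conjI)
  with M(1) show ?thesis by (intro bexI[of _ M] ballI)
qed

definition magnus :: "'x set \<Rightarrow> ('x \<times> bool) list set \<Rightarrow> 'x list \<Rightarrow> int" where
  "magnus A = (SOME M. M \<in> hom (free_group A) (series_monoid A) \<and>
     (\<forall>a\<in>A. M (free_gen A a) = magnus_letter a True \<and>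
           M (inv\<^bsub>free_group A\<^esub> (free_gen A a)) = magnus_letter a False))"

lemma magnus_hom: "magnus A \<in> hom (free_group A) (series_monoid A)"
  and magnus_gen: "a \<in> A \<Longrightarrow> magnus A (free_gen A a) = magnus_letter a True"
  and magnus_inv_gen:
    "a \<in> A \<Longrightarrow> magnus A (inv\<^bsub>free_group A\<^esub> (free_gen A a)) = magnus_letter a False"
proof -
  let ?P = "\<lambda>M. M \<in> hom (free_group A) (series_monoid A) \<and>
     (\<forall>a\<in>A. M (free_gen A a) = magnus_letter a True \<and>
           M (inv\<^bsub>free_group A\<^esub> (free_gen A a)) = magnus_letter a False)"
  have "Ex ?P" using magnus_exists by (simp only: Bex_def)
  then have *: "?P (magnus A)"
    unfolding magnus_def by (rule someI_ex)
  then show "magnus A \<in> hom (free_group A) (series_monoid A)"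
    by (rule conjunct1)
  show "a \<in> A \<Longrightarrow> magnus A (free_gen A a) = magnus_letter a True"
    "a \<in> A \<Longrightarrow> magnus A (inv\<^bsub>free_group A\<^esub> (free_gen A a)) = magnus_letter a False"
    using conjunct2[OF *] by blast+
qed

lemma magnus_in_carrier: "U \<in> carrier (free_group A) \<Longrightarrow> magnus A U \<in> carrier (series_monoid A)"
  using magnus_hom by (rule hom_in_carrier)

lemma magnus_Nil: "U \<in> carrier (free_group A) \<Longrightarrow> magnus A U [] = 1"
  using magnus_in_carrier[of U A] by (simp add: series_monoid_def)

lemma magnus_support: "U \<in> carrier (free_group A) \<Longrightarrow> magnus A U w \<noteq> 0 \<Longrightarrow> w \<in> lists A"
  using magnus_in_carrier[of U A] lists_mono by (fastforce simp: series_monoid_def)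

lemma magnus_mult:
  "U \<in> carrier (free_group A) \<Longrightarrow> V \<in> carrier (free_group A) \<Longrightarrow>
     magnus A (U \<otimes>\<^bsub>free_group A\<^esub> V) = ser_mult (magnus A U) (magnus A V)"
  using magnus_hom[of A] by (simp add: hom_mult)

text \<open>The target is only a monoid, so preservation of the unit is not automatic. But the image is an
  idempotent with constant term one, and its lowest term \<open>c\<close> would have to satisfy \<open>c = c + c\<close>.\<close>
lemma magnus_one: "magnus A \<one>\<^bsub>free_group A\<^esub> = ser_one"
proof -
  interpret group "free_group A" by (rule group_free_group)
  let ?f = "magnus A \<one>\<^bsub>free_group A\<^esub>"
  have idem: "ser_mult ?f ?f = ?f" using magnus_mult[of "\<one>\<^bsub>free_group A\<^esub>" A "\<one>\<^bsub>free_group A\<^esub>"] by simp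
  have "?f w = ser_one w" for w
  proof (induction w rule: length_induct)
    case (1 w)
    show ?case
    proof (cases "w = []")
      case False
      have "ser_mult ?f ?f w = ?f w + ?f w"
        by (rule ser_mult_low_left) (use 1 False in \<open>auto simp: magnus_Nil ser_one_def\<close>)
      then show ?thesis using idem False by (simp add: ser_one_def)
    qed (simp add: magnus_Nil ser_one_def)
  qed
  then show ?thesis by auto
qed

text \<open>A series in the single letter \<open>a\<close> of the form \<open>1 + e a + \<dots>\<close>. The image of the power \<open>a\<^sup>e\<close> has this
  form. The exponent \<open>e\<close>, which may be negative, is recovered as the linear coefficient.\<close>
definition univariate :: "'x \<Rightarrow> int \<Rightarrow> ('x list \<Rightarrow> int) \<Rightarrow> bool" where
  "univariate a e f \<longleftrightarrow> f [] = 1 \<and> f [a] = e \<and> (\<forall>w. f w \<noteq> 0 \<longrightarrow> set w \<subseteq> {a})"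

lemma univariate_mult:
  assumes "univariate a d f" "univariate a e g"
  shows "univariate a (d + e) (ser_mult f g)"
proof -
  have "set w \<subseteq> {a}" if nz: "ser_mult f g w \<noteq> 0" for w
    using ser_mult_nonzeroD[OF nz] assms unfolding univariate_def by fastforce
  then show ?thesis using assms by (auto simp: univariate_def)
qed

lemma univariate_magnus_pow:
  assumes "a \<in> A"
  shows "univariate a e (magnus A (free_gen A a [^]\<^bsub>free_group A\<^esub> (e::int)))"
proof -
  interpret group "free_group A" by (rule group_free_group)
  note a = free_gen_in_carrier[OF assms]
  have "univariate a 1 (magnus_letter a True)" "univariate a (- 1) (magnus_letter a False)"
    by (auto simp: univariate_def magnus_letter_def)
  then have step: "univariate a 1 (magnus A (free_gen A a [^]\<^bsub>free_group A\<^esub> (1::int)))"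
    "univariate a (- 1) (magnus A (free_gen A a [^]\<^bsub>free_group A\<^esub> (- 1::int)))"
    using a by (simp_all add: magnus_gen magnus_inv_gen assms int_pow_neg)
  show ?thesis
  proof (induction e rule: int_induct[where k = 0])
    case base
    show ?case by (simp add: magnus_one univariate_def ser_one_def)
  next
    case (step1 i)
    show ?case using univariate_mult[OF step1(2) step(1)] a
      by (simp add: int_pow_mult magnus_mult del: int_pow_1)
  next
    case (step2 i)
    show ?case using univariate_mult[OF step2(2) step(2)] int_pow_mult[OF a, of i "- 1"] a
      by (simp add: magnus_mult)
  qed
qed

text \<open>On a word without adjacent equal letters, a factor that is a series in \<open>a\<close> can only use up a
  prefix of length at most one.\<close>
lemma univariate_mult_coeff:
  assumes f: "univariate a e f" and w: "distinct_adj (c # w)"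
  shows "ser_mult f g (c # w) = g (c # w) + (if c = a then e * g w else 0)"
proof (cases "c = a")
  case False
  then have "(\<lambda>u. f (c # u)) = (\<lambda>u. 0)" using f by (fastforce simp: univariate_def)
  then show ?thesis using f False by (simp add: ser_mult_zero_left univariate_def)
next
  case True
  show ?thesis
  proof (cases w)
    case (Cons b v)
    then have "b \<noteq> a" using w True by auto
    then have "(\<lambda>u. f (a # b # u)) = (\<lambda>u. 0)" using f by (fastforce simp: univariate_def)
    then show ?thesis using f True Cons by (simp add: ser_mult_zero_left univariate_def)
  qed (use f True in \<open>simp add: univariate_def\<close>)
qed

text \<open>Reduced words, with maximal powers of one generator grouped together: \<open>L\<close> lists the letters of the
  groups, whose exponents are not zero.\<close>
inductive syllables :: "'x set \<Rightarrow> 'x list \<Rightarrow> ('x \<times> bool) list set \<Rightarrow> bool" for A where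
  Nil: "syllables A [] \<one>\<^bsub>free_group A\<^esub>"
| Cons: "\<lbrakk>a \<in> A; e \<noteq> 0; syllables A L U; L = [] \<or> hd L \<noteq> a\<rbrakk>
    \<Longrightarrow> syllables A (a # L) (free_gen A a [^]\<^bsub>free_group A\<^esub> (e::int) \<otimes>\<^bsub>free_group A\<^esub> U)"

lemma syllables_in_carrier: "syllables A L U \<Longrightarrow> U \<in> carrier (free_group A)"
  by (induction rule: syllables.induct)
     (auto simp: group_free_group group.is_monoid free_gen_in_carrier group.int_pow_closed monoid.m_closed)

lemma syllables_pow_mult:
  assumes "syllables A L U" "a \<in> A"
  shows "\<exists>L. syllables A L (free_gen A a [^]\<^bsub>free_group A\<^esub> (d::int) \<otimes>\<^bsub>free_group A\<^esub> U)"
proof -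
  interpret group "free_group A" by (rule group_free_group)
  note a = free_gen_in_carrier[OF assms(2)]
  have U: "U \<in> carrier (free_group A)" using assms(1) by (rule syllables_in_carrier)
  consider "d = 0" | "d \<noteq> 0" "L = [] \<or> hd L \<noteq> a" | "L \<noteq> []" "hd L = a" by blast
  then show ?thesis
  proof cases
    case 1
    then show ?thesis using assms(1) U by auto
  next
    case 2
    then show ?thesis using syllables.Cons[OF assms(2) _ assms(1)] by blast
  next
    case 3
    from assms(1) 3 obtain e L' V where V: "L = a # L'" "e \<noteq> 0" "syllables A L' V"
      "L' = [] \<or> hd L' \<noteq> a" and eq: "U = free_gen A a [^]\<^bsub>free_group A\<^esub> (e::int) \<otimes>\<^bsub>free_group A\<^esub> V"
      by (cases rule: syllables.cases) auto
    have "V \<in> carrier (free_group A)" using V by (intro syllables_in_carrier)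
    then have *: "free_gen A a [^]\<^bsub>free_group A\<^esub> d \<otimes>\<^bsub>free_group A\<^esub> U
        = free_gen A a [^]\<^bsub>free_group A\<^esub> (d + e) \<otimes>\<^bsub>free_group A\<^esub> V"
      using a by (simp add: eq int_pow_mult m_assoc)
    show ?thesis
    proof (cases "d + e = 0")
      case True
      then show ?thesis unfolding * using V \<open>V \<in> _\<close> by auto
    next
      case False
      then show ?thesis unfolding * using syllables.Cons[OF assms(2) False V(3,4)] by blast
    qed
  qed
qed

lemma syllables_exists: "U \<in> carrier (free_group A) \<Longrightarrow> \<exists>L. syllables A L U"
proof (induction rule: free_group_induct)
  case one
  show ?case using syllables.Nil by blast
next
  interpret group "free_group A" by (rule group_free_group)
  {
    case (gen a U)
    then show ?case using syllables_pow_mult[of A _ U a 1] free_gen_in_carrier[of a A] by auto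
  next
    case (inv_gen a U)
    then show ?case using syllables_pow_mult[of A _ U a "- 1"] free_gen_in_carrier[of a A]
      by (auto simp: int_pow_neg)
  }
qed

text \<open>Magnus's injectivity argument. The coefficient at \<open>L\<close> is the product of the exponents, since the only
  way to obtain this word is to take the linear term of each factor. The vanishing at longer words
  without adjacent equal letters is what keeps the induction going.\<close>
lemma magnus_syllables:
  assumes "syllables A L U"
  shows "distinct_adj L \<and> magnus A U L \<noteq> 0 \<and>
    (\<forall>w. distinct_adj w \<longrightarrow> length w > length L \<longrightarrow> magnus A U w = 0)"
  using assms
proof (induction rule: syllables.induct)
  case Nil
  show ?case by (auto simp: magnus_one ser_one_def)
next
  case (Cons a e L U)
  interpret group "free_group A" by (rule group_free_group)
  have U: "U \<in> carrier (free_group A)" using Cons by (intro syllables_in_carrier)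
  let ?f = "magnus A (free_gen A a [^]\<^bsub>free_group A\<^esub> e)"
  have eq: "magnus A (free_gen A a [^]\<^bsub>free_group A\<^esub> e \<otimes>\<^bsub>free_group A\<^esub> U) = ser_mult ?f (magnus A U)"
    using U free_gen_in_carrier[OF \<open>a \<in> A\<close>] by (simp add: magnus_mult)
  note coeff = univariate_mult_coeff[OF univariate_magnus_pow[OF \<open>a \<in> A\<close>]]
  have da: "distinct_adj (a # L)" using Cons by (cases L) auto
  moreover have "ser_mult ?f (magnus A U) (a # L) \<noteq> 0"
    using Cons.hyps(2) Cons.IH da by (auto simp add: coeff[OF da] simp del: ser_mult.simps)
  moreover have "ser_mult ?f (magnus A U) w = 0"
    if w: "distinct_adj w" "length w > length (a # L)" for w
  proof (cases w)
    case (Cons c v)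
    then have "distinct_adj v" using w by (cases v) auto
    then show ?thesis using Cons.IH w Cons coeff[of c v e "magnus A U"]
      using \<open>distinct_adj L \<and> _\<close> by auto
  qed (use w in simp)
  ultimately show ?case unfolding eq by blast
qed

lemma magnus_eq_oneD:
  assumes "U \<in> carrier (free_group A)" "magnus A U = ser_one"
  shows "U = \<one>\<^bsub>free_group A\<^esub>"
proof -
  obtain L where L: "syllables A L U" using syllables_exists[OF assms(1)] by blast
  then have "ser_one L \<noteq> 0" using magnus_syllables assms(2) by metis
  then have "L = []" by (simp add: ser_one_def split: if_splits)
  with L show ?thesis by (auto elim: syllables.cases)
qed


section \<open>Ordering free groups by leading coefficients\<close>

lemma total_on_lenlex:
  assumes "total_on A r"
  shows "total_on (lists A) (lenlex r)"
proof (rule total_onI)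
  fix v w assume "v \<in> lists A" "w \<in> lists A" "v \<noteq> w"
  then show "(v, w) \<in> lenlex r \<or> (w, v) \<in> lenlex r"
  proof (induction v arbitrary: w)
    case (Cons a v)
    show ?case
    proof (cases w)
      case (Cons b u)
      with Cons.IH[of u] Cons.prems Cons.hyps assms show ?thesis
        by (cases "length u = length v") (auto simp: Cons_lenlex_iff total_on_def)
    qed simp
  qed (cases w, auto)
qed

definition leading :: "('x \<times> 'x) set \<Rightarrow> ('x list \<Rightarrow> int) \<Rightarrow> 'x list \<Rightarrow> bool" where
  "leading r f w \<longleftrightarrow> w \<noteq> [] \<and> f w \<noteq> 0 \<and> (\<forall>u. u \<noteq> [] \<longrightarrow> (u, w) \<in> lenlex r \<longrightarrow> f u = 0)"

text \<open>Comparing words by length and then lexicographically is not a well-order over an infinite alphabet, but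
  it is one over the finitely many letters \<open>B\<close> that occur in the series.\<close>
lemma leading_exists:
  assumes "Relation.trans r" "irrefl r" and f: "f \<in> carrier (series_monoid A)" "f \<noteq> ser_one"
  shows "\<exists>w. leading r f w"
proof -
  have "\<exists>B. finite B \<and> B \<subseteq> A \<and> (\<forall>w. f w \<noteq> 0 \<longrightarrow> w \<in> lists B)" and Nil: "f [] = 1"
    using f(1) by (simp_all add: series_monoid_def)
  then obtain B where B: "finite B" "\<forall>w. f w \<noteq> 0 \<longrightarrow> w \<in> lists B" by blast
  let ?r = "r \<inter> B \<times> B"
  have "acyclic r" using assms by (simp add: acyclic_irrefl)
  then have "acyclic ?r" by (rule acyclic_subset) blast
  with B(1) have "wf ?r" by (intro finite_acyclic_wf) simp_all
  then have "wf (lenlex ?r)" by (rule wf_lenlex)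
  obtain u where "f u \<noteq> ser_one u" using f(2) by (meson ext)
  then have "u \<in> {u. u \<noteq> [] \<and> f u \<noteq> 0}" using Nil by (simp add: ser_one_def split: if_splits)
  with \<open>wf (lenlex ?r)\<close> obtain w where "w \<in> {u. u \<noteq> [] \<and> f u \<noteq> 0}"
    and min: "\<And>u. (u, w) \<in> lenlex ?r \<Longrightarrow> u \<notin> {u. u \<noteq> [] \<and> f u \<noteq> 0}"
    by (rule wfE_min) simp
  then have w: "w \<noteq> []" "f w \<noteq> 0" by simp_all
  \<comment> \<open>For words over \<open>B\<close>, comparing with \<open>r\<close> is the same as comparing with its restriction to \<open>B\<close>.\<close>
  have restrict: "(u, w) \<in> lenlex ?r" if "(u, w) \<in> lenlex r" "u \<in> lists B" "w \<in> lists B" for u w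
    using that
  proof (induction u arbitrary: w)
    case (Cons a u)
    then show ?case by (cases w) (auto simp: Cons_lenlex_iff)
  qed simp
  have "f u = 0" if "u \<noteq> []" "(u, w) \<in> lenlex r" for u
  proof (rule ccontr)
    assume "f u \<noteq> 0"
    moreover from this have "u \<in> lists B" "w \<in> lists B" using B(2) w(2) by simp_all
    ultimately show False using min[OF restrict[OF that(2)]] that(1) by simp
  qed
  with w have "leading r f w" by (simp add: leading_def)
  then show ?thesis by blast
qed

lemma leading_shorter:
  "leading r f w \<Longrightarrow> u \<noteq> [] \<Longrightarrow> length u < length w \<Longrightarrow> f u = 0"
  by (simp add: leading_def lenlex_conv)

lemma leading_scale:
  assumes "leading r f w" "c \<noteq> 0" and "\<And>u. u \<noteq> [] \<Longrightarrow> length u \<le> length w \<Longrightarrow> g u = c * f u"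
  shows "leading r g w"
  using assms lenlex_length[of _ w r] unfolding leading_def by simp

text \<open>The leading word of the product is the smaller of the two leading words. If they coincide, the
  coefficients add up, and two positive numbers do not cancel.\<close>
lemma leading_mult:
  assumes r: "Relation.trans r" "irrefl r" "total_on A r"
    and f: "f [] = 1" "leading r f v" "f v > 0" "v \<in> lists A"
    and g: "g [] = 1" "leading r g w" "g w > 0" "w \<in> lists A"
  shows "\<exists>u. leading r (ser_mult f g) u \<and> ser_mult f g u > 0"
proof -
  have low: "ser_mult f g u = f u + g u" if "u \<noteq> []" "length u \<le> length v" for u
    using that f g leading_shorter[OF f(2)] by (intro ser_mult_low_left) auto
  have f0: "f u = 0" if "u \<noteq> []" "(u, v) \<in> lenlex r" for u
    using that f(2) by (simp add: leading_def)
  have g0: "g u = 0" if "u \<noteq> []" "(u, w) \<in> lenlex r" for u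
    using that g(2) by (simp add: leading_def)
  have ne: "v \<noteq> []" "w \<noteq> []" using f(2) g(2) by (simp_all add: leading_def)
  consider "v = w" | "(v, w) \<in> lenlex r" | "(w, v) \<in> lenlex r"
    using total_on_lenlex[OF r(3)] f(4) g(4) unfolding total_on_def by blast
  then show ?thesis
  proof cases
    case 1
    have "ser_mult f g u = 0" if "u \<noteq> []" "(u, v) \<in> lenlex r" for u
      using that low lenlex_length[OF that(2)] f0 g0 1 by simp
    then have "leading r (ser_mult f g) v \<and> ser_mult f g v > 0"
      using low[of v] ne f(3) g(3) 1 by (auto simp: leading_def)
    then show ?thesis by blast
  next
    case 2
    have "ser_mult f g u = 0" if "u \<noteq> []" "(u, v) \<in> lenlex r" for u
      using that low lenlex_length[OF that(2)] f0 g0 lenlex_trans[OF that(2) 2 r(1)] by simp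
    then have "leading r (ser_mult f g) v \<and> ser_mult f g v > 0"
      using low[of v] g0[OF ne(1) 2] ne f(3) by (auto simp: leading_def)
    then show ?thesis by blast
  next
    case 3
    have len: "length w \<le> length v" using 3 by (rule lenlex_length)
    have "ser_mult f g u = 0" if "u \<noteq> []" "(u, w) \<in> lenlex r" for u
      using that low lenlex_length[OF that(2)] len f0 g0 lenlex_trans[OF that(2) 3 r(1)] by simp
    then have "leading r (ser_mult f g) w \<and> ser_mult f g w > 0"
      using low[of w] len f0[OF ne(2) 3] ne g(3) by (auto simp: leading_def)
    then show ?thesis by blast
  qed
qed

text \<open>With \<open>h = f g f\<inverse>\<close>, written without inverses: conjugation leaves all coefficients up to the lowest
  degree \<open>d\<close> of \<open>g - 1\<close> unchanged, because there both sides of \<open>h f = f g\<close> are sums.\<close>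
lemma conj_low_coeff:
  assumes one: "f [] = 1" "g [] = 1" "h [] = 1" and eq: "ser_mult h f = ser_mult f g"
    and low: "\<And>u. u \<noteq> [] \<Longrightarrow> length u < d \<Longrightarrow> g u = 0"
    and "u \<noteq> []" "length u \<le> d"
  shows "h u = g u"
  using assms(6,7)
proof (induction u rule: length_induct)
  case (1 u)
  have "ser_mult h f u = h u + f u"
  proof (rule ser_mult_low_left)
    fix v :: "'a list" assume "v \<noteq> []" "length v < length u"
    then show "h v = 0" using 1 low[of v] by simp
  qed (use one 1 in auto)
  moreover have "ser_mult f g u = f u + g u"
    using 1 low one by (intro ser_mult_low_right) auto
  ultimately show ?case using eq by simp
qed

definition magnus_cone :: "'x set \<Rightarrow> ('x \<times> 'x) set \<Rightarrow> ('x \<times> bool) list set set" where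
  "magnus_cone A r =
     {U \<in> carrier (free_group A). \<exists>w. leading r (magnus A U) w \<and> magnus A U w > 0}"

theorem bi_cone_magnus_cone:
  assumes r: "Relation.trans r" "irrefl r" "total_on A r"
  shows "bi_cone (free_group A) (magnus_cone A r)"
proof -
  interpret group "free_group A" by (rule group_free_group)
  let ?F = "free_group A" and ?M = "magnus A"
  show ?thesis
    unfolding invariant_cone_def
  proof (intro conjI ballI impI)
    show "magnus_cone A r \<subseteq> carrier ?F" by (auto simp: magnus_cone_def)
    show "\<one>\<^bsub>?F\<^esub> \<notin> magnus_cone A r"
      by (auto simp: magnus_cone_def magnus_one leading_def ser_one_def)
  next
    fix U V assume "U \<in> magnus_cone A r" "V \<in> magnus_cone A r"
    then obtain v w where U: "U \<in> carrier ?F" "leading r (?M U) v" "?M U v > 0"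
      and V: "V \<in> carrier ?F" "leading r (?M V) w" "?M V w > 0"
      by (auto simp: magnus_cone_def)
    have "\<exists>u. leading r (ser_mult (?M U) (?M V)) u \<and> ser_mult (?M U) (?M V) u > 0"
      using U V magnus_support[OF U(1), of v] magnus_support[OF V(1), of w]
      by (intro leading_mult[OF r, of _ v _ w]) (simp_all add: magnus_Nil)
    then show "U \<otimes>\<^bsub>?F\<^esub> V \<in> magnus_cone A r"
      using U(1) V(1) by (simp add: magnus_cone_def magnus_mult)
  next
    fix U V assume U: "U \<in> carrier ?F" and "V \<in> magnus_cone A r"
    then obtain w where V: "V \<in> carrier ?F" "leading r (?M V) w" "?M V w > 0"
      by (auto simp: magnus_cone_def)
    \<comment> \<open>Stating \<open>W = U V U\<inverse>\<close> as \<open>W U = U V\<close> keeps the series of \<open>U\<inverse>\<close> out of the comparison.\<close>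
    define W where "W = U \<otimes>\<^bsub>?F\<^esub> V \<otimes>\<^bsub>?F\<^esub> inv\<^bsub>?F\<^esub> U"
    have W: "W \<in> carrier ?F" and WU: "W \<otimes>\<^bsub>?F\<^esub> U = U \<otimes>\<^bsub>?F\<^esub> V"
      using U V(1) by (simp_all add: W_def m_assoc)
    have eq: "ser_mult (?M W) (?M U) = ser_mult (?M U) (?M V)"
      using WU by (simp flip: magnus_mult[OF W U] magnus_mult[OF U V(1)])
    have "?M W u = ?M V u" if "u \<noteq> []" "length u \<le> length w" for u
      using leading_shorter[OF V(2)] that
      by (intro conj_low_coeff[OF _ _ _ eq, of "length w"]) (simp_all add: magnus_Nil U V(1) W)
    moreover from this have "leading r (?M W) w"
      by (intro leading_scale[OF V(2), of 1]) simp_all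
    moreover have "w \<noteq> []" using V(2) by (simp add: leading_def)
    ultimately have "leading r (?M W) w \<and> ?M W w > 0" using V(3) by simp
    then show "U \<otimes>\<^bsub>?F\<^esub> V \<otimes>\<^bsub>?F\<^esub> inv\<^bsub>?F\<^esub> U \<in> magnus_cone A r"
      using W by (auto simp: magnus_cone_def W_def)
  next
    fix U assume U: "U \<in> carrier ?F" "U \<noteq> \<one>\<^bsub>?F\<^esub>"
    then have "?M U \<noteq> ser_one" using magnus_eq_oneD[OF U(1)] by blast
    then obtain w where w: "leading r (?M U) w"
      using leading_exists[OF r(1,2) magnus_in_carrier[OF U(1)]] by blast
    have eq: "ser_mult (?M U) (?M (inv\<^bsub>?F\<^esub> U)) = ser_one"
      using U(1) by (simp add: magnus_one flip: magnus_mult)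
    \<comment> \<open>The lowest terms of \<open>U\<close> and its inverse cancel in the product, so they have opposite signs.\<close>
    have inv: "?M (inv\<^bsub>?F\<^esub> U) u = - ?M U u" if "u \<noteq> []" "length u \<le> length w" for u
    proof -
      have "ser_mult (?M U) (?M (inv\<^bsub>?F\<^esub> U)) u = ?M U u + ?M (inv\<^bsub>?F\<^esub> U) u"
        using leading_shorter[OF w] that U(1) by (intro ser_mult_low_left) (auto simp: magnus_Nil)
      then show ?thesis using eq that(1) by (simp add: ser_one_def)
    qed
    have "leading r (?M (inv\<^bsub>?F\<^esub> U)) w"
      using inv by (intro leading_scale[OF w, of "- 1"]) simp_all
    moreover have "?M (inv\<^bsub>?F\<^esub> U) w = - ?M U w" "?M U w \<noteq> 0"
      using w inv[of w] by (auto simp: leading_def)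
    ultimately have "?M U w > 0 \<or> leading r (?M (inv\<^bsub>?F\<^esub> U)) w \<and> ?M (inv\<^bsub>?F\<^esub> U) w > 0" by linarith
    then show "U \<in> magnus_cone A r \<or> inv\<^bsub>?F\<^esub> U \<in> magnus_cone A r"
      using w U(1) inv_closed[OF U(1)] unfolding magnus_cone_def by blast
  qed
qed

text \<open>The series \<open>f'\<close> arises from \<open>f\<close>, a series over the alphabet \<open>A\<close>, by renaming letters. The second part
  forces the terms of \<open>f'\<close> to come from \<open>f\<close>; it is needed because \<open>\<sigma>\<close> may fail to be surjective.\<close>
definition relabelled :: "'x set \<Rightarrow> ('x \<Rightarrow> 'x) \<Rightarrow> ('x list \<Rightarrow> int) \<Rightarrow> ('x list \<Rightarrow> int) \<Rightarrow> bool" where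
  "relabelled A \<sigma> f f' \<longleftrightarrow> (\<forall>w\<in>lists A. f' (map \<sigma> w) = f w) \<and> (\<forall>u. f' u \<noteq> 0 \<longrightarrow> u \<in> map \<sigma> ` lists A)"

lemma ser_mult_relabelled:
  assumes "\<And>w. w \<in> lists A \<Longrightarrow> f' (map \<sigma> w) = f w" "\<And>w. w \<in> lists A \<Longrightarrow> g' (map \<sigma> w) = g w"
    and "w \<in> lists A"
  shows "ser_mult f' g' (map \<sigma> w) = ser_mult f g w"
  using assms(3,1)
proof (induction w arbitrary: f f')
  case Nil
  then show ?case using assms(2)[of "[]"] Nil(1)[of "[]"] by simp
next
  case (Cons a w)
  have "ser_mult (\<lambda>u. f' (\<sigma> a # u)) g' (map \<sigma> w) = ser_mult (\<lambda>u. f (a # u)) g w"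
  proof (rule Cons.IH)
    fix v assume "v \<in> lists A"
    then show "f' (\<sigma> a # map \<sigma> v) = f (a # v)" using Cons.prems[of "a # v"] Cons.hyps by simp
  qed
  then show ?case using assms(2)[of "a # w"] Cons.prems[of "[]"] Cons.hyps by simp
qed

lemma relabelled_mult:
  assumes "relabelled A \<sigma> f f'" "relabelled A \<sigma> g g'"
  shows "relabelled A \<sigma> (ser_mult f g) (ser_mult f' g')"
proof -
  have "u \<in> map \<sigma> ` lists A" if nz: "ser_mult f' g' u \<noteq> 0" for u
  proof -
    obtain v w where u: "u = v @ w" "f' v \<noteq> 0" "g' w \<noteq> 0" using ser_mult_nonzeroD[OF nz] by blast
    then obtain v' w' where "v = map \<sigma> v'" "v' \<in> lists A" "w = map \<sigma> w'" "w' \<in> lists A"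
      using assms unfolding relabelled_def by blast
    then show ?thesis using u(1) by (intro image_eqI[of _ _ "v' @ w'"]) auto
  qed
  then show ?thesis
    using assms ser_mult_relabelled[of A f' \<sigma> f g' g] unfolding relabelled_def by blast
qed

lemma relabelled_magnus:
  assumes "\<sigma> ` A \<subseteq> A" "inj_on \<sigma> A" "U \<in> carrier (free_group A)"
  shows "relabelled A \<sigma> (magnus A U) (magnus A (free_group_map A \<sigma> U))"
proof -
  interpret group "free_group A" by (rule group_free_group)
  interpret h: group_hom "free_group A" "free_group A" "free_group_map A \<sigma>"
    using free_group_map_hom[OF assms(1)] by unfold_locales
  have letter: "relabelled A \<sigma> (magnus_letter a b) (magnus_letter (\<sigma> a) b)" if "a \<in> A" for a b
  proof -
    have "map \<sigma> w = [\<sigma> a] \<longleftrightarrow> w = [a]" "set (map \<sigma> w) \<subseteq> {\<sigma> a} \<longleftrightarrow> set w \<subseteq> {a}"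
      if "w \<in> lists A" for w
      using that \<open>a \<in> A\<close> assms(2) by (auto simp: in_lists_conv_set map_eq_Cons_conv inj_on_eq_iff)
    moreover have "u \<in> map \<sigma> ` lists A" if "set u \<subseteq> {\<sigma> a}" for u
    proof -
      have "u = replicate (length u) (\<sigma> a)" using that by (intro replicate_eqI) auto
      then have "u = map \<sigma> (replicate (length u) a)" by simp
      then show ?thesis by (rule image_eqI) (use \<open>a \<in> A\<close> in \<open>auto simp: in_lists_conv_set\<close>)
    qed
    ultimately show ?thesis
      unfolding relabelled_def by (auto simp: magnus_letter_def split: if_splits)
  qed
  show ?thesis
    using assms(3)
  proof (induction rule: free_group_induct)
    case one
    show ?case by (auto simp: magnus_one relabelled_def ser_one_def)
  next
    case (gen a U)
    then show ?case
      using relabelled_mult[OF letter[of a True] gen(3)] free_gen_in_carrier[of _ A] assms(1)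
      by (simp add: magnus_mult magnus_gen free_group_map_gen image_subset_iff)
  next
    case (inv_gen a U)
    then show ?case
      using relabelled_mult[OF letter[of a False] inv_gen(3)] free_gen_in_carrier[of _ A] assms(1)
      by (simp add: magnus_mult magnus_inv_gen free_group_map_gen image_subset_iff)
  qed
qed

text \<open>Renaming letters in an order-preserving way maps the leading word to the leading word and keeps its
  coefficient.\<close>
theorem magnus_cone_order_automorphism:
  assumes "\<sigma> ` A \<subseteq> A" "inj_on \<sigma> A"
    and mono: "\<And>a b. a \<in> A \<Longrightarrow> b \<in> A \<Longrightarrow> (\<sigma> a, \<sigma> b) \<in> r \<longleftrightarrow> (a, b) \<in> r"
    and "U \<in> magnus_cone A r"
  shows "free_group_map A \<sigma> U \<in> magnus_cone A r"
proof -
  obtain w where U: "U \<in> carrier (free_group A)" and w: "leading r (magnus A U) w" "magnus A U w > 0"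
    using assms(4) by (auto simp: magnus_cone_def)
  let ?V = "free_group_map A \<sigma> U"
  have V: "?V \<in> carrier (free_group A)"
    using free_group_map_hom[OF assms(1)] U by (rule hom_in_carrier)
  have wA: "w \<in> lists A" using magnus_support[OF U, of w] w by simp
  have rel: "\<And>v. v \<in> lists A \<Longrightarrow> magnus A ?V (map \<sigma> v) = magnus A U v"
    "\<And>u. magnus A ?V u \<noteq> 0 \<Longrightarrow> u \<in> map \<sigma> ` lists A"
    using relabelled_magnus[OF assms(1,2) U] by (auto simp: relabelled_def)
  have lenlex: "(map \<sigma> u, map \<sigma> v) \<in> lenlex r \<longleftrightarrow> (u, v) \<in> lenlex r"
    if "u \<in> lists A" "v \<in> lists A" for u v
    using that
  proof (induction u arbitrary: v)
    case Nil
    then show ?case by (cases v) auto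
  next
    case (Cons a u)
    then show ?case using mono inj_on_eq_iff[OF assms(2)] by (cases v) (auto simp: Cons_lenlex_iff)
  qed
  have "magnus A ?V u = 0" if u: "u \<noteq> []" "(u, map \<sigma> w) \<in> lenlex r" for u
  proof (rule ccontr)
    assume nz: "magnus A ?V u \<noteq> 0"
    then obtain v where v: "u = map \<sigma> v" "v \<in> lists A" using rel(2) by blast
    then have "(v, w) \<in> lenlex r" "v \<noteq> []" using u lenlex wA by auto
    then have "magnus A U v = 0" using w(1) by (simp add: leading_def)
    then show False using nz v rel(1) by simp
  qed
  then have "leading r (magnus A ?V) (map \<sigma> w)"
    using w wA rel(1) by (simp add: leading_def)
  moreover have "magnus A ?V (map \<sigma> w) > 0" using w(2) rel(1)[OF wA] by simp
  ultimately show ?thesis using V unfolding magnus_cone_def by blast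
qed


section \<open>Semidirect products\<close>

definition semidirect ::
    "('a, 'c) monoid_scheme \<Rightarrow> ('h, 'd) monoid_scheme \<Rightarrow> ('h \<Rightarrow> 'a \<Rightarrow> 'a) \<Rightarrow> ('a \<times> 'h) monoid" where
  "semidirect N H \<theta> =
     \<lparr>carrier = carrier N \<times> carrier H,
      monoid.mult = (\<lambda>(x, h) (y, k). (x \<otimes>\<^bsub>N\<^esub> \<theta> h y, h \<otimes>\<^bsub>H\<^esub> k)),
      one = (\<one>\<^bsub>N\<^esub>, \<one>\<^bsub>H\<^esub>)\<rparr>"

lemma carrier_semidirect [simp]: "carrier (semidirect N H \<theta>) = carrier N \<times> carrier H"
  and mult_semidirect [simp]:
    "(x, h) \<otimes>\<^bsub>semidirect N H \<theta>\<^esub> (y, k) = (x \<otimes>\<^bsub>N\<^esub> \<theta> h y, h \<otimes>\<^bsub>H\<^esub> k)"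
  and one_semidirect [simp]: "\<one>\<^bsub>semidirect N H \<theta>\<^esub> = (\<one>\<^bsub>N\<^esub>, \<one>\<^bsub>H\<^esub>)"
  by (simp_all add: semidirect_def)

lemma group_semidirect:
  assumes "group N" "group H"
    and hom: "\<And>h. h \<in> carrier H \<Longrightarrow> \<theta> h \<in> hom N N"
    and comp: "\<And>h k x. h \<in> carrier H \<Longrightarrow> k \<in> carrier H \<Longrightarrow> x \<in> carrier N
                \<Longrightarrow> \<theta> (h \<otimes>\<^bsub>H\<^esub> k) x = \<theta> h (\<theta> k x)"
    and one: "\<And>x. x \<in> carrier N \<Longrightarrow> \<theta> \<one>\<^bsub>H\<^esub> x = x"
  shows "group (semidirect N H \<theta>)"
proof -
  interpret N: group N by fact
  interpret H: group H by fact
  have closed: "\<theta> h x \<in> carrier N" if "h \<in> carrier H" "x \<in> carrier N" for h x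
    using hom_in_carrier[OF hom[OF that(1)] that(2)] .
  have mult: "\<theta> h (x \<otimes>\<^bsub>N\<^esub> y) = \<theta> h x \<otimes>\<^bsub>N\<^esub> \<theta> h y"
    if "h \<in> carrier H" "x \<in> carrier N" "y \<in> carrier N" for h x y
    using hom_mult[OF hom[OF that(1)] that(2,3)] .
  have th_one: "\<theta> h \<one>\<^bsub>N\<^esub> = \<one>\<^bsub>N\<^esub>" if "h \<in> carrier H" for h
    using hom_one[OF hom[OF that] assms(1,1)] .
  show ?thesis
  proof (rule groupI)
    fix p assume "p \<in> carrier (semidirect N H \<theta>)"
    then obtain x h where p: "p = (x, h)" "x \<in> carrier N" "h \<in> carrier H" by auto
    have "(\<theta> (inv\<^bsub>H\<^esub> h) (inv\<^bsub>N\<^esub> x), inv\<^bsub>H\<^esub> h) \<otimes>\<^bsub>semidirect N H \<theta>\<^esub> p = \<one>\<^bsub>semidirect N H \<theta>\<^esub>"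
      using p by (simp add: th_one flip: mult)
    then show "\<exists>q\<in>carrier (semidirect N H \<theta>). q \<otimes>\<^bsub>semidirect N H \<theta>\<^esub> p = \<one>\<^bsub>semidirect N H \<theta>\<^esub>"
      using p closed by (intro bexI[of _ "(\<theta> (inv\<^bsub>H\<^esub> h) (inv\<^bsub>N\<^esub> x), inv\<^bsub>H\<^esub> h)"]) auto
  qed (auto simp: closed mult comp one N.m_assoc H.m_assoc)
qed


section \<open>Free products with a retraction onto one factor\<close>

text \<open>The images \<open>t\<close> of the free generators determine a retraction of \<open>F\<^sub>A * G\<close> onto \<open>G\<close>.\<close>
locale retraction_data =
  fixes A :: "'x set" and G :: "('g, 'b) monoid_scheme" and t :: "'x \<Rightarrow> 'g"
  assumes group_G: "group G" and t: "t ` A \<subseteq> carrier G"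
begin

interpretation G: group G by (rule group_G)

abbreviation basis :: "('g \<times> 'x) set" where
  "basis \<equiv> carrier G \<times> A"

definition translate :: "'g \<Rightarrow> 'g \<times> 'x \<Rightarrow> 'g \<times> 'x" where
  "translate g = (\<lambda>(h, a). (g \<otimes>\<^bsub>G\<^esub> h, a))"

definition act :: "'g \<Rightarrow> (('g \<times> 'x) \<times> bool) list set \<Rightarrow> (('g \<times> 'x) \<times> bool) list set" where
  "act g = free_group_map basis (translate g)"

abbreviation "FX \<equiv> free_group basis"
abbreviation "E \<equiv> semidirect FX G act"
abbreviation "FP \<equiv> free_product (free_group A) G"
abbreviation "inl \<equiv> free_product_inl (free_group A) G"
abbreviation "inr \<equiv> free_product_inr (free_group A) G"

interpretation FX: group FX by (rule group_free_group)
interpretation FA: group "free_group A" by (rule group_free_group)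
interpretation FP: group FP by (rule group_free_product[OF group_free_group group_G])
interpretation inl: group_hom "free_group A" FP inl
  using free_product_inl_hom[OF group_free_group] by unfold_locales
interpretation inr: group_hom G FP inr
  using free_product_inr_hom[OF group_G] by unfold_locales

lemma translate_basis: "g \<in> carrier G \<Longrightarrow> translate g ` basis \<subseteq> basis"
  by (auto simp: translate_def)

lemma inj_translate: "g \<in> carrier G \<Longrightarrow> inj_on (translate g) basis"
  by (auto simp: translate_def inj_on_def)

lemma act_hom: "g \<in> carrier G \<Longrightarrow> act g \<in> hom FX FX"
  unfolding act_def by (rule free_group_map_hom[OF translate_basis])

lemma act_gen:
  "g \<in> carrier G \<Longrightarrow> h \<in> carrier G \<Longrightarrow> a \<in> A \<Longrightarrow>
     act g (free_gen basis (h, a)) = free_gen basis (g \<otimes>\<^bsub>G\<^esub> h, a)"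
  using free_group_map_gen[OF translate_basis, of g "(h, a)"] by (simp add: act_def translate_def)

lemma act_mult:
  assumes "g \<in> carrier G" "h \<in> carrier G" "U \<in> carrier FX"
  shows "act (g \<otimes>\<^bsub>G\<^esub> h) U = act g (act h U)"
proof -
  have "act (g \<otimes>\<^bsub>G\<^esub> h) U = (act g \<circ> act h) U"
  proof (rule free_group_hom_unique[OF group_free_group _ _ _ assms(3)])
    show "act g \<circ> act h \<in> hom FX FX"
      using hom_compose[OF act_hom[OF assms(2)] act_hom[OF assms(1)]] .
  qed (use assms in \<open>auto simp: act_hom act_gen G.m_assoc\<close>)
  then show ?thesis by simp
qed

lemma act_one:
  assumes "U \<in> carrier FX"
  shows "act \<one>\<^bsub>G\<^esub> U = U"
proof -
  have "(\<lambda>U. U) \<in> hom FX FX" by (simp add: hom_def)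
  from free_group_hom_unique[OF group_free_group act_hom[OF G.one_closed] this _ assms]
  show ?thesis by (auto simp: act_gen)
qed

lemma act_in_carrier: "g \<in> carrier G \<Longrightarrow> U \<in> carrier FX \<Longrightarrow> act g U \<in> carrier FX"
  using hom_in_carrier[OF act_hom] .

lemma group_E: "group E"
  by (rule group_semidirect) (simp_all add: group_G group_free_group act_hom act_mult act_one)

text \<open>Since \<open>x\<^bsub>(1,a)\<^esub> = a t\<^sub>a\<inverse>\<close>, the generator \<open>a\<close> has to go to the product of \<open>x\<^bsub>(1,a)\<^esub>\<close> and
  \<open>t\<^sub>a\<close>.\<close>
lemma to_semidirect:
  obtains \<Phi> where "\<Phi> \<in> hom FP E"
    "\<And>a. a \<in> A \<Longrightarrow> \<Phi> (inl (free_gen A a)) = (free_gen basis (\<one>\<^bsub>G\<^esub>, a), t a)"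
    "\<And>g. g \<in> carrier G \<Longrightarrow> \<Phi> (inr g) = (\<one>\<^bsub>FX\<^esub>, g)"
proof -
  have "(\<lambda>a. (free_gen basis (\<one>\<^bsub>G\<^esub>, a), t a)) ` A \<subseteq> carrier E"
    using t by (auto simp: free_gen_in_carrier)
  from free_group_universal[OF group_E this] obtain \<phi> where \<phi>: "\<phi> \<in> hom (free_group A) E"
    "\<And>a. a \<in> A \<Longrightarrow> \<phi> (free_gen A a) = (free_gen basis (\<one>\<^bsub>G\<^esub>, a), t a)" by blast
  have "act g \<one>\<^bsub>FX\<^esub> = \<one>\<^bsub>FX\<^esub>" if "g \<in> carrier G" for g
    using hom_one[OF act_hom[OF that] group_free_group group_free_group] .
  then have "(\<lambda>g. (\<one>\<^bsub>FX\<^esub>, g)) \<in> hom G E" by (intro homI) auto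
  from free_product_universal[OF group_free_group group_G group_E \<phi>(1) this] \<phi>(2)
  show ?thesis using that free_gen_in_carrier by metis
qed

text \<open>In the other direction \<open>x\<^bsub>(g,a)\<^esub>\<close> goes to \<open>g a t\<^sub>a\<inverse> g\<inverse>\<close>. This is compatible with the action, as
  conjugation by \<open>h\<close> turns the \<open>g\<close> in this expression into \<open>hg\<close>.\<close>
lemma from_semidirect:
  obtains \<Theta> where "\<Theta> \<in> hom E FP"
    "\<And>a. a \<in> A \<Longrightarrow> \<Theta> (free_gen basis (\<one>\<^bsub>G\<^esub>, a), t a) = inl (free_gen A a)"
    "\<And>g. g \<in> carrier G \<Longrightarrow> \<Theta> (\<one>\<^bsub>FX\<^esub>, g) = inr g"
proof -
  define s where "s = (\<lambda>(g, a). inr g \<otimes>\<^bsub>FP\<^esub> (inl (free_gen A a) \<otimes>\<^bsub>FP\<^esub> inv\<^bsub>FP\<^esub> inr (t a)) \<otimes>\<^bsub>FP\<^esub> inv\<^bsub>FP\<^esub> inr g)"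
  have tc: "t a \<in> carrier G" if "a \<in> A" for a using t that by blast
  have "s ` basis \<subseteq> carrier FP"
    by (auto simp: s_def free_gen_in_carrier tc)
  from free_group_universal[OF FP.is_group this] obtain \<Psi> where \<Psi>: "\<Psi> \<in> hom FX FP"
    and gen: "\<And>g a. g \<in> carrier G \<Longrightarrow> a \<in> A \<Longrightarrow> \<Psi> (free_gen basis (g, a)) = s (g, a)" by blast
  interpret \<Psi>: group_hom FX FP \<Psi> using \<Psi> by unfold_locales
  have equivariant: "inr g \<otimes>\<^bsub>FP\<^esub> \<Psi> U = \<Psi> (act g U) \<otimes>\<^bsub>FP\<^esub> inr g"
    if g: "g \<in> carrier G" and U: "U \<in> carrier FX" for g U
  proof -
    have cancel: "inv\<^bsub>FP\<^esub> inr g \<otimes>\<^bsub>FP\<^esub> (inr g \<otimes>\<^bsub>FP\<^esub> x) = x" if "x \<in> carrier FP" for x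
      using that g by (simp flip: FP.m_assoc)
    have "(\<lambda>U. inr g \<otimes>\<^bsub>FP\<^esub> \<Psi> U \<otimes>\<^bsub>FP\<^esub> inv\<^bsub>FP\<^esub> inr g) \<in> hom FX FP"
      using g by (intro homI) (simp_all add: FP.m_assoc cancel)
    moreover have "(\<Psi> \<circ> act g) \<in> hom FX FP"
      using hom_compose[OF act_hom[OF g] \<Psi>] .
    ultimately have "inr g \<otimes>\<^bsub>FP\<^esub> \<Psi> U \<otimes>\<^bsub>FP\<^esub> inv\<^bsub>FP\<^esub> inr g = (\<Psi> \<circ> act g) U"
    proof (rule free_group_hom_unique[OF FP.is_group _ _ _ U])
      fix x assume "x \<in> basis"
      then obtain h a where x: "x = (h, a)" "h \<in> carrier G" "a \<in> A" by auto
      then show "inr g \<otimes>\<^bsub>FP\<^esub> \<Psi> (free_gen basis x) \<otimes>\<^bsub>FP\<^esub> inv\<^bsub>FP\<^esub> inr g = (\<Psi> \<circ> act g) (free_gen basis x)"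
        using g by (simp add: gen act_gen s_def FP.inv_mult_group FP.m_assoc free_gen_in_carrier tc)
    qed
    then have "\<Psi> (act g U) \<otimes>\<^bsub>FP\<^esub> inr g = inr g \<otimes>\<^bsub>FP\<^esub> \<Psi> U \<otimes>\<^bsub>FP\<^esub> inv\<^bsub>FP\<^esub> inr g \<otimes>\<^bsub>FP\<^esub> inr g"
      by simp
    then show ?thesis using g U by (simp add: FP.m_assoc)
  qed
  define \<Theta> where "\<Theta> = (\<lambda>(U, g). \<Psi> U \<otimes>\<^bsub>FP\<^esub> inr g)"
  have "\<Theta> \<in> hom E FP"
  proof (rule homI)
    fix p q assume "p \<in> carrier E" "q \<in> carrier E"
    then obtain U g V h where p: "p = (U, g)" "U \<in> carrier FX" "g \<in> carrier G"
      and q: "q = (V, h)" "V \<in> carrier FX" "h \<in> carrier G" by auto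
    have "\<Psi> U \<otimes>\<^bsub>FP\<^esub> (\<Psi> (act g V) \<otimes>\<^bsub>FP\<^esub> inr g) \<otimes>\<^bsub>FP\<^esub> inr h
        = \<Psi> U \<otimes>\<^bsub>FP\<^esub> (inr g \<otimes>\<^bsub>FP\<^esub> \<Psi> V) \<otimes>\<^bsub>FP\<^esub> inr h"
      using equivariant p q by simp
    then show "\<Theta> (p \<otimes>\<^bsub>E\<^esub> q) = \<Theta> p \<otimes>\<^bsub>FP\<^esub> \<Theta> q"
      using p q by (simp add: \<Theta>_def FP.m_assoc act_in_carrier)
  qed (auto simp: \<Theta>_def)
  moreover have "\<Theta> (free_gen basis (\<one>\<^bsub>G\<^esub>, a), t a) = inl (free_gen A a)" if "a \<in> A" for a
    using that by (simp add: \<Theta>_def gen s_def free_gen_in_carrier tc FP.m_assoc)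
  moreover have "\<Theta> (\<one>\<^bsub>FX\<^esub>, g) = inr g" if "g \<in> carrier G" for g
    using that by (simp add: \<Theta>_def)
  ultimately show ?thesis using that by blast
qed

lemma free_product_unique:
  fixes K :: "('k, 'l) monoid_scheme"
  assumes K: "group K" and h: "h \<in> hom FP K" and k: "k \<in> hom FP K" and x: "x \<in> carrier FP"
    and l: "\<And>a. a \<in> A \<Longrightarrow> h (inl (free_gen A a)) = k (inl (free_gen A a))"
    and r: "\<And>g. g \<in> carrier G \<Longrightarrow> h (inr g) = k (inr g)"
  shows "h x = k x"
proof (rule free_product_hom_unique[OF group_free_group group_G K h k _ r x])
  fix U assume U: "U \<in> carrier (free_group A)"
  have "(h \<circ> inl) U = (k \<circ> inl) U"
    using free_group_hom_unique[OF K hom_compose[OF inl.homh h] hom_compose[OF inl.homh k] _ U] l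
    by simp
  then show "h (inl U) = k (inl U)" by simp
qed

text \<open>The two homomorphisms above compose to the identity on generators of the free product, so the first
  one is injective.\<close>
theorem retraction_embedding:
  assumes \<pi>: "\<pi> \<in> hom FP G" "\<And>a. a \<in> A \<Longrightarrow> \<pi> (inl (free_gen A a)) = t a"
    "\<And>g. g \<in> carrier G \<Longrightarrow> \<pi> (inr g) = g"
  shows "\<exists>\<Phi>\<in>hom FP E. inj_on \<Phi> (carrier FP) \<and> (\<forall>x\<in>carrier FP. snd (\<Phi> x) = \<pi> x)"
proof -
  obtain \<Phi> where \<Phi>: "\<Phi> \<in> hom FP E"
    "\<And>a. a \<in> A \<Longrightarrow> \<Phi> (inl (free_gen A a)) = (free_gen basis (\<one>\<^bsub>G\<^esub>, a), t a)"
    "\<And>g. g \<in> carrier G \<Longrightarrow> \<Phi> (inr g) = (\<one>\<^bsub>FX\<^esub>, g)" using to_semidirect by blast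
  obtain \<Theta> where \<Theta>: "\<Theta> \<in> hom E FP"
    "\<And>a. a \<in> A \<Longrightarrow> \<Theta> (free_gen basis (\<one>\<^bsub>G\<^esub>, a), t a) = inl (free_gen A a)"
    "\<And>g. g \<in> carrier G \<Longrightarrow> \<Theta> (\<one>\<^bsub>FX\<^esub>, g) = inr g" using from_semidirect by blast
  have "\<Theta> (\<Phi> x) = x" if "x \<in> carrier FP" for x
  proof -
    have "(\<lambda>x. x) \<in> hom FP FP" by (simp add: hom_def)
    from free_product_unique[OF FP.is_group hom_compose[OF \<Phi>(1) \<Theta>(1)] this that] \<Phi> \<Theta>
    show ?thesis by simp
  qed
  then have "inj_on \<Phi> (carrier FP)" by (rule inj_on_inverseI)
  moreover have "snd (\<Phi> x) = \<pi> x" if "x \<in> carrier FP" for x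
  proof -
    have "snd \<in> hom E G" by (intro homI) auto
    then have s: "snd \<circ> \<Phi> \<in> hom FP G" using hom_compose[OF \<Phi>(1)] by blast
    show ?thesis
      using free_product_unique[OF group_G s \<pi>(1) that] \<Phi>(2,3) \<pi>(2,3) by simp
  qed
  ultimately show ?thesis using \<Phi>(1) by blast
qed

text \<open>On the kernel of \<open>\<pi>\<close> the embedding has trivial second component, so its first component \<open>u\<close> is an
  injective homomorphism into the free group on \<open>basis\<close>; the cone is pulled back along it. Conjugation
  by \<open>g\<close> becomes the action of \<open>\<pi> g\<close> followed by conjugation by \<open>u g\<close>, whence the two invariance
  conditions on \<open>C\<close>.\<close>
theorem kernel_cone:
  assumes \<pi>: "\<pi> \<in> hom FP G" "\<And>a. a \<in> A \<Longrightarrow> \<pi> (inl (free_gen A a)) = t a"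
      "\<And>g. g \<in> carrier G \<Longrightarrow> \<pi> (inr g) = g"
    and C: "bi_cone FX C" and C_act: "\<And>g U. g \<in> carrier G \<Longrightarrow> U \<in> C \<Longrightarrow> act g U \<in> C"
  shows "\<exists>D. invariant_cone FP (kernel FP G \<pi>) D"
proof -
  interpret \<pi>: group_hom FP G \<pi> using \<pi>(1) by unfold_locales
  have "\<exists>\<Phi>\<in>hom FP E. inj_on \<Phi> (carrier FP) \<and> (\<forall>x\<in>carrier FP. snd (\<Phi> x) = \<pi> x)"
    by (rule retraction_embedding) (simp_all add: \<pi>)
  then obtain \<Phi> where \<Phi>: "\<Phi> \<in> hom FP E" "inj_on \<Phi> (carrier FP)"
    and snd: "\<forall>x\<in>carrier FP. snd (\<Phi> x) = \<pi> x" by (elim bexE conjE)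
  interpret \<Phi>: group_hom FP E \<Phi>
    using \<Phi>(1) group_E FP.is_group by (simp add: group_hom_def group_hom_axioms_def)
  note C = invariant_coneD[OF C]
  define u where "u x = fst (\<Phi> x)" for x
  have \<Phi>_eq: "\<Phi> x = (u x, \<pi> x)" if "x \<in> carrier FP" for x
    using snd that by (simp add: u_def prod_eq_iff)
  have u_closed: "u x \<in> carrier FX" if "x \<in> carrier FP" for x
    using \<Phi>.hom_closed[OF that] \<Phi>_eq[OF that] by simp
  have u_mult: "u (x \<otimes>\<^bsub>FP\<^esub> y) = u x \<otimes>\<^bsub>FX\<^esub> act (\<pi> x) (u y)"
    if "x \<in> carrier FP" "y \<in> carrier FP" for x y
    using \<Phi>.hom_mult[OF that] that by (simp add: \<Phi>_eq)
  have u_one: "u \<one>\<^bsub>FP\<^esub> = \<one>\<^bsub>FX\<^esub>"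
    using \<Phi>.hom_one by (simp add: u_def)
  let ?K = "kernel FP G \<pi>"
  have K: "x \<in> carrier FP" "\<pi> x = \<one>\<^bsub>G\<^esub>" if "x \<in> ?K" for x
    using that by (simp_all add: kernel_def)
  have "invariant_cone FP ?K {x \<in> ?K. u x \<in> C}"
    unfolding invariant_cone_def
  proof (intro conjI ballI impI)
    show "{x \<in> ?K. u x \<in> C} \<subseteq> ?K" by blast
    show "\<one>\<^bsub>FP\<^esub> \<notin> {x \<in> ?K. u x \<in> C}" using C(2) by (simp add: u_one)
  next
    fix x y assume "x \<in> {x \<in> ?K. u x \<in> C}" "y \<in> {x \<in> ?K. u x \<in> C}"
    then have x: "x \<in> carrier FP" "\<pi> x = \<one>\<^bsub>G\<^esub>" "u x \<in> C"
      and y: "y \<in> carrier FP" "\<pi> y = \<one>\<^bsub>G\<^esub>" "u y \<in> C"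
      by (simp_all add: kernel_def)
    have "u (x \<otimes>\<^bsub>FP\<^esub> y) = u x \<otimes>\<^bsub>FX\<^esub> u y"
      using x y by (simp add: u_mult act_one u_closed)
    then show "x \<otimes>\<^bsub>FP\<^esub> y \<in> {x \<in> ?K. u x \<in> C}"
      using x y C(3) by (simp add: kernel_def)
  next
    fix g x assume g: "g \<in> carrier FP" and "x \<in> {x \<in> ?K. u x \<in> C}"
    then have x: "x \<in> carrier FP" "\<pi> x = \<one>\<^bsub>G\<^esub>" "u x \<in> C" by (simp_all add: kernel_def)
    \<comment> \<open>Applying \<open>u\<close> to \<open>y g = g x\<close> needs no formula for inverses in the semidirect product.\<close>
    define y where "y = g \<otimes>\<^bsub>FP\<^esub> x \<otimes>\<^bsub>FP\<^esub> inv\<^bsub>FP\<^esub> g"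
    have y: "y \<in> carrier FP" "\<pi> y = \<one>\<^bsub>G\<^esub>" and yg: "y \<otimes>\<^bsub>FP\<^esub> g = g \<otimes>\<^bsub>FP\<^esub> x"
      using g x by (simp_all add: y_def FP.m_assoc)
    have "u y \<otimes>\<^bsub>FX\<^esub> u g = u g \<otimes>\<^bsub>FX\<^esub> act (\<pi> g) (u x)"
      using arg_cong[OF yg, of u] g x y by (simp add: u_mult act_one u_closed)
    then have "u y = u g \<otimes>\<^bsub>FX\<^esub> act (\<pi> g) (u x) \<otimes>\<^bsub>FX\<^esub> inv\<^bsub>FX\<^esub> u g"
      using g x y by (subst FX.inv_solve_right) (simp_all add: u_closed act_in_carrier)
    also have "\<dots> \<in> C" using g x(3) by (intro C(4) C_act) (simp_all add: u_closed)
    finally have "y \<in> {x \<in> ?K. u x \<in> C}" using y by (simp add: kernel_def)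
    then show "g \<otimes>\<^bsub>FP\<^esub> x \<otimes>\<^bsub>FP\<^esub> inv\<^bsub>FP\<^esub> g \<in> {x \<in> ?K. u x \<in> C}" unfolding y_def .
  next
    fix x assume "x \<in> ?K" and ne: "x \<noteq> \<one>\<^bsub>FP\<^esub>"
    note x = K[OF \<open>x \<in> ?K\<close>]
    have "\<Phi> x \<noteq> \<Phi> \<one>\<^bsub>FP\<^esub>" 
      using ne by (simp only: inj_on_eq_iff[OF \<Phi>(2) x(1) FP.one_closed] not_False_eq_True)
    then have "u x \<noteq> \<one>\<^bsub>FX\<^esub>" using x by (simp add: \<Phi>_eq u_one)
    moreover have "u (inv\<^bsub>FP\<^esub> x) \<otimes>\<^bsub>FX\<^esub> u x = \<one>\<^bsub>FX\<^esub>"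
      using u_mult[of "inv\<^bsub>FP\<^esub> x" x] x by (simp add: u_one act_one u_closed)
    then have "u (inv\<^bsub>FP\<^esub> x) = inv\<^bsub>FX\<^esub> u x"
      using x by (intro FX.inv_equality[symmetric]) (simp_all add: u_closed)
    ultimately show "x \<in> {x \<in> ?K. u x \<in> C} \<or> inv\<^bsub>FP\<^esub> x \<in> {x \<in> ?K. u x \<in> C}"
      using C(5)[OF u_closed[OF x(1)]] x by (auto simp: kernel_def)
  qed
  then show ?thesis by blast
qed

end


section \<open>Fiber products\<close>

text \<open>The second projection has kernel \<open>kernel G1 Q p1 \<times> 1\<close>, on which \<open>(g1, g2)\<close> acts through conjugation
  by \<open>g1\<close>.\<close>
lemma bi_orderable_fiber_product:
  assumes groups: "group G1" "group G2" "group Q" and homs: "p1 \<in> hom G1 Q" "p2 \<in> hom G2 Q"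
    and "bi_cone G2 C" and "invariant_cone G1 (kernel G1 Q p1) D"
  shows "bi_orderable (fiber_product G1 G2 p1 p2)"
proof -
  let ?P = "fiber_product G1 G2 p1 p2"
  interpret G1: group G1 by fact
  interpret G2: group G2 by fact
  interpret p1: group_hom G1 Q p1 using groups homs by (simp add: group_hom_def group_hom_axioms_def)
  interpret p2: group_hom G2 Q p2 using groups homs by (simp add: group_hom_def group_hom_axioms_def)
  note D = invariant_coneD[OF assms(7)]
  have carrier: "(x, y) \<in> carrier ?P \<longleftrightarrow> x \<in> carrier G1 \<and> y \<in> carrier G2 \<and> p1 x = p2 y" for x y
    by (simp add: fiber_product_def)
  have mult [simp]: "(x, y) \<otimes>\<^bsub>?P\<^esub> (x', y') = (x \<otimes>\<^bsub>G1\<^esub> x', y \<otimes>\<^bsub>G2\<^esub> y')" for x y x' y'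
    by (simp add: fiber_product_def)
  have one [simp]: "\<one>\<^bsub>?P\<^esub> = (\<one>\<^bsub>G1\<^esub>, \<one>\<^bsub>G2\<^esub>)" by (simp add: fiber_product_def)
  have "?P = (G1 \<times>\<times> G2)\<lparr>carrier := carrier ?P\<rparr>" by (simp add: fiber_product_def)
  then have P: "group ?P"
    using subgroup.subgroup_is_group[OF subgroup_fiber_product[OF groups homs] DirProd_group[OF groups(1,2)]]
    by simp
  have inv: "inv\<^bsub>?P\<^esub> (x, y) = (inv\<^bsub>G1\<^esub> x, inv\<^bsub>G2\<^esub> y)" if "(x, y) \<in> carrier ?P" for x y
    using that by (intro group.inv_equality[OF P]) (auto simp: carrier)
  have "snd \<in> hom ?P G2" by (rule homI) (auto simp: fiber_product_def)
  then have snd: "group_hom ?P G2 snd" using P groups by (simp add: group_hom_def group_hom_axioms_def)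
  have kernel: "kernel ?P G2 snd = kernel G1 Q p1 \<times> {\<one>\<^bsub>G2\<^esub>}"
    by (auto simp: kernel_def carrier)
  have "invariant_cone ?P (kernel ?P G2 snd) (D \<times> {\<one>\<^bsub>G2\<^esub>})"
    unfolding invariant_cone_def
  proof (intro conjI ballI impI)
    show "D \<times> {\<one>\<^bsub>G2\<^esub>} \<subseteq> kernel ?P G2 snd" using D(1) by (auto simp: kernel)
    show "\<one>\<^bsub>?P\<^esub> \<notin> D \<times> {\<one>\<^bsub>G2\<^esub>}" using D(2) by simp
  next
    fix p q assume "p \<in> D \<times> {\<one>\<^bsub>G2\<^esub>}" "q \<in> D \<times> {\<one>\<^bsub>G2\<^esub>}"
    then show "p \<otimes>\<^bsub>?P\<^esub> q \<in> D \<times> {\<one>\<^bsub>G2\<^esub>}" using D(3) by auto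
  next
    fix g p assume g: "g \<in> carrier ?P" and "p \<in> D \<times> {\<one>\<^bsub>G2\<^esub>}"
    then obtain x where p: "p = (x, \<one>\<^bsub>G2\<^esub>)" "x \<in> D" by auto
    obtain g1 g2 where "g = (g1, g2)" by (cases g)
    then show "g \<otimes>\<^bsub>?P\<^esub> p \<otimes>\<^bsub>?P\<^esub> inv\<^bsub>?P\<^esub> g \<in> D \<times> {\<one>\<^bsub>G2\<^esub>}"
      using g p D(4) by (simp add: inv carrier)
  next
    fix p assume "p \<in> kernel ?P G2 snd" and "p \<noteq> \<one>\<^bsub>?P\<^esub>"
    then obtain x where p: "p = (x, \<one>\<^bsub>G2\<^esub>)" "x \<in> kernel G1 Q p1" "x \<noteq> \<one>\<^bsub>G1\<^esub>"
      by (auto simp: kernel)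
    then have "(x, \<one>\<^bsub>G2\<^esub>) \<in> carrier ?P" by (simp add: carrier kernel_def)
    from inv[OF this] show "p \<in> D \<times> {\<one>\<^bsub>G2\<^esub>} \<or> inv\<^bsub>?P\<^esub> p \<in> D \<times> {\<one>\<^bsub>G2\<^esub>}"
      using p D(5)[of x] by simp
  qed
  from bi_cone_extension[OF snd assms(6) this] show ?thesis
    using bi_orderable_if_bi_cone[OF P] by blast
qed

section \<open>The fiber product over a left-orderable group\<close>

theorem theorem1p2:
  fixes G :: "('a, 'b) monoid_scheme"
    and n :: nat
    and s :: "nat \<Rightarrow> 'a"
    and \<pi>\<^sub>1 :: "((nat \<times> bool) list set + 'a) list set \<Rightarrow> 'a"
    and \<pi>\<^sub>2 :: "(nat \<times> bool) list set \<Rightarrow> 'a"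
  assumes "group G"
    and "carrier G \<noteq> {\<one>\<^bsub>G\<^esub>}"
    and "left_orderable G"
    and "s ` {1..n} \<subseteq> carrier G"
    and "generate G (s ` {1..n}) = carrier G"
    and "\<pi>\<^sub>2 \<in> epi (free_group {1..n}) G"
    and "\<And>i. i \<in> {1..n} \<Longrightarrow> \<pi>\<^sub>2 (free_gen {1..n} i) = s i"
    and "\<pi>\<^sub>1 \<in> epi (free_product (free_group {1..n}) G) G"
    and "\<And>x. x \<in> carrier (free_group {1..n}) \<Longrightarrow>
           \<pi>\<^sub>1 (free_product_inl (free_group {1..n}) G x) = \<pi>\<^sub>2 x"
    and "\<And>g. g \<in> carrier G \<Longrightarrow> \<pi>\<^sub>1 (free_product_inr (free_group {1..n}) G g) = g"
  shows "bi_orderable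
           (fiber_product (free_product (free_group {1..n}) G) (free_group {1..n}) \<pi>\<^sub>1 \<pi>\<^sub>2)"
proof -
  interpret G: group G by fact
  interpret retraction_data "{1..n}" G s using assms(1,4) by unfold_locales
  have homs: "\<pi>\<^sub>1 \<in> hom FP G" "\<pi>\<^sub>2 \<in> hom (free_group {1..n}) G" using assms(6,8) by (simp_all add: epi_def)
  obtain r where r: "Relation.trans r" "irrefl r" "total_on (carrier G) r"
    and r_left: "\<And>g x y. g \<in> carrier G \<Longrightarrow> x \<in> carrier G \<Longrightarrow> y \<in> carrier G \<Longrightarrow> (x, y) \<in> r
      \<Longrightarrow> (g \<otimes>\<^bsub>G\<^esub> x, g \<otimes>\<^bsub>G\<^esub> y) \<in> r"
    using assms(3) unfolding left_orderable_def strict_linear_order_on_def by blast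
  \<comment> \<open>The Magnus cone needs translations to reflect the order as well; apply the inverse translation.\<close>
  have r_iff: "(g \<otimes>\<^bsub>G\<^esub> x, g \<otimes>\<^bsub>G\<^esub> y) \<in> r \<longleftrightarrow> (x, y) \<in> r"
    if "g \<in> carrier G" "x \<in> carrier G" "y \<in> carrier G" for g x y
    using that r_left[of "inv\<^bsub>G\<^esub> g" "g \<otimes>\<^bsub>G\<^esub> x" "g \<otimes>\<^bsub>G\<^esub> y"] r_left[of g x y]
    by (auto simp: G.m_assoc[symmetric])
  let ?r = "r <*lex*> less_than"
  have order: "Relation.trans ?r" "irrefl ?r" "total_on basis ?r"
    using r by (auto intro!: total_on_lex_prod simp: total_on_def irrefl_def)
  have "act g U \<in> magnus_cone basis ?r" if "g \<in> carrier G" "U \<in> magnus_cone basis ?r" for g U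
    unfolding act_def
    by (rule magnus_cone_order_automorphism[OF translate_basis inj_translate])
       (use that in \<open>auto simp: translate_def r_iff\<close>)
  then obtain D where "invariant_cone FP (kernel FP G \<pi>\<^sub>1) D"
    using kernel_cone[OF homs(1) _ _ bi_cone_magnus_cone[OF order]] assms(7,9,10)
    by (auto simp: free_gen_in_carrier)
  moreover have "bi_cone (free_group {1..n}) (magnus_cone {1..n} less_than)"
    by (rule bi_cone_magnus_cone) (auto simp: irrefl_def total_on_def)
  ultimately show ?thesis
    using bi_orderable_fiber_product[OF group_free_product[OF group_free_group assms(1)]
        group_free_group assms(1) homs] by blast
qed

end
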